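(* Let $t_n=\frac{3}{4}n\log n-\frac{1}{4}n\log\log n-c_n n$ be a sequence of natural numbers with $\lim_{n\to\infty}c_n=\infty$. Then $\lim_{n\to\infty}d_n(t_n)=1$, where $$d_n(t)=\max_{\sigma\in S_n}\left\Vert \mathbb{P}^n_\sigma(\Pi_t\in\cdot)-\mathbb{U}^n\right\Vert_{TV}.$$
   Context: The random-to-random insertions shuffle on a deck of $n$ cards numbered $1,\dots,n$: at each step a card is chosen uniformly at random, removed from the deck, and reinserted at a uniformly random position (among the $n$ positions). An ordering of the deck is identified with the permutation $\sigma\in S_n$ such that $\sigma(j)$ is the position of card $j$. The shuffle induces a random walk $\Pi_t$, $t=0,1,\dots$, on $S_n$, and $\mathbb{P}^n_\sigma$ denotes the law of this walk started from $\Pi_0=\sigma$. $\mathbb{U}^n$ denotes the uniform measure on $S_n$ and $\|\cdot\|_{TV}$ the total variation distance. $\log$ is the natural logarithm. *)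

theory Defs
  imports "HOL-Probability.Probability" "HOL-Combinatorics.Permutations"
begin

text \<open>Cards are numbered 0,...,n-1 and positions are 0,...,n-1. An ordering of the
deck is a permutation sigma of {..<n} (identity outside), sigma j = position of card j.\<close>

definition deck_orders :: "nat \<Rightarrow> (nat \<Rightarrow> nat) set" where
  "deck_orders n = {\<sigma>. \<sigma> permutes {..<n}}"

text \<open>Remove card j from the deck (ordering sigma) and reinsert it so that it ends up
at position k; other cards keep their relative order.\<close>
definition rti_move :: "(nat \<Rightarrow> nat) \<Rightarrow> nat \<Rightarrow> nat \<Rightarrow> (nat \<Rightarrow> nat)" where
  "rti_move \<sigma> j k = (\<lambda>i. if i = j then k else
      (let q = \<sigma> i; q' = (if q > \<sigma> j then q - 1 else q)
       in if q' \<ge> k then q' + 1 else q'))"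

definition rti_step :: "nat \<Rightarrow> (nat \<Rightarrow> nat) \<Rightarrow> (nat \<Rightarrow> nat) pmf" where
  "rti_step n \<sigma> = (if n = 0 then return_pmf \<sigma> else
     bind_pmf (pmf_of_set {..<n}) (\<lambda>j.
     bind_pmf (pmf_of_set {..<n}) (\<lambda>k. return_pmf (rti_move \<sigma> j k))))"

definition rti_walk :: "nat \<Rightarrow> (nat \<Rightarrow> nat) \<Rightarrow> nat \<Rightarrow> (nat \<Rightarrow> nat) pmf" where
  "rti_walk n \<sigma> t = ((\<lambda>p. bind_pmf p (rti_step n)) ^^ t) (return_pmf \<sigma>)"

definition uniform_perm :: "nat \<Rightarrow> (nat \<Rightarrow> nat) pmf" where
  "uniform_perm n = pmf_of_set (deck_orders n)"

definition tv_dist :: "'a pmf \<Rightarrow> 'a pmf \<Rightarrow> real" where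
  "tv_dist p q = (SUP A. \<bar>measure_pmf.prob p A - measure_pmf.prob q A\<bar>)"

definition rti_d :: "nat \<Rightarrow> nat \<Rightarrow> real" where
  "rti_d n t = Max ((\<lambda>\<sigma>. tv_dist (rti_walk n \<sigma> t) (uniform_perm n)) ` deck_orders n)"

end

theory Submission
imports Defs "HOL-Real_Asymp.Real_Asymp"
begin

text \<open>
Count the cards within distance \<open>w = L \<surd>(n log n)\<close> of their initial position, where
\<open>L\<close> tends slowly to infinity. Under the uniform measure this number has standard deviation
of order \<open>\<surd>w\<close>. After \<open>t\<close> steps about \<open>m = n (1 - 1/n)^t \<ge> e^(c - 1) (n log n)^(1/4)\<close> cards
have not yet been removed; these move diffusively, so nearly all of them are still within
distance \<open>w\<close>. As \<open>m\<close> dominates \<open>\<surd>w\<close>, the statistic separates the two measures, provided that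
the contribution of the removed cards, centred, has second moment \<open>O(w)\<close>.

For the latter, a single removed card is exactly uniform. For a pair of removed cards, condition on
the last time at which one of them, say \<open>y\<close>, was chosen: then \<open>y\<close> is uniform given the rank of \<open>x\<close>
among the other cards, and this rank differs by at most one from the uniform position of \<open>x\<close>.
So the error is governed by the variation of the later evolution in the starting rank of
\<open>x\<close>, which is bounded by monotonicity.
\<close>

subsection \<open>Steps and single cards\<close>

definition move :: "nat \<Rightarrow> nat \<Rightarrow> nat \<Rightarrow> nat" where
  "move a k q = (if q = a then k else
     (let q' = (if q > a then q - 1 else q) in if q' \<ge> k then q' + 1 else q'))"

text \<open>Position of a card of rank \<open>r\<close> among the others, once the removed card is
  put back at \<open>k\<close>.\<close>

definition ins :: "nat \<Rightarrow> nat \<Rightarrow> nat" where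
  "ins k r = (if r \<ge> k then r + 1 else r)"

lemma move_same [simp]: "move a k a = k"
  by (simp add: move_def)

lemma move_inverse [simp]: "move k a (move a k q) = q"
  by (auto simp: move_def Let_def)

lemma move_eq_iff [simp]: "move a k x = move a k y \<longleftrightarrow> x = y"
  by (metis move_inverse)

lemma move_less: "a < n \<Longrightarrow> k < n \<Longrightarrow> q < n \<Longrightarrow> move a k q < n"
  by (auto simp: move_def Let_def)

lemma bij_betw_move: "a < n \<Longrightarrow> k < n \<Longrightarrow> bij_betw (move a k) {..<n} {..<n}"
  by (rule bij_betwI[where g = "move k a"]) (auto simp: move_less)

lemma move_conv_ins: "x \<noteq> a \<Longrightarrow> move a k x = ins k (if a < x then x - 1 else x)"
  by (auto simp: move_def ins_def)

lemma bij_betw_ins: "u < n \<Longrightarrow> bij_betw (ins u) {..<n - 1} ({..<n} - {u})"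
  by (rule bij_betwI[where g = "\<lambda>x. if u < x then x - 1 else x"])
     (auto simp: ins_def split: if_splits)

text \<open>Injectivity lets the test for card \<open>j\<close> be replaced by a test for its
  position, so a step acts on positions alone.\<close>

lemma rti_move_conv_move: "inj \<sigma> \<Longrightarrow> rti_move \<sigma> j k = move (\<sigma> j) k \<circ> \<sigma>"
  by (auto simp: rti_move_def move_def Let_def fun_eq_iff inj_eq)

lemma sum_move: "a < n \<Longrightarrow> k < n \<Longrightarrow> (\<Sum>x<n. f (move a k x)) = (\<Sum>x<n. f x)"
  by (rule sum.reindex_bij_betw[OF bij_betw_move])

lemma bij_betw_move_remove: 
  assumes "a < n" "k < n" shows "bij_betw (move a k) ({..<n} - {a}) ({..<n} - {k})"
  using bij_betw_DiffI[OF bij_betw_move[OF assms], of "{a}" "{k}"] assms by (auto simp: bij_betw_def)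

text \<open>A step \<open>(a, k)\<close> moves the card at position \<open>a\<close> to position \<open>k\<close>; positions rather than
labels make the steps independent of the deck. The head of the list is the most recent step. A card
is identified by its initial position. In \<open>late \<omega> x y\<close>, the last of the two cards to be chosen
is \<open>y\<close>, at a time when \<open>x\<close> has been removed before.\<close>

fun pos :: "(nat \<times> nat) list \<Rightarrow> nat \<Rightarrow> nat" where
  "pos [] x = x"
| "pos ((a, k) # \<omega>) x = move a k (pos \<omega> x)"

fun removed :: "(nat \<times> nat) list \<Rightarrow> nat \<Rightarrow> bool" where
  "removed [] x = False"
| "removed ((a, k) # \<omega>) x = (a = pos \<omega> x \<or> removed \<omega> x)"

fun late :: "(nat \<times> nat) list \<Rightarrow> nat \<Rightarrow> nat \<Rightarrow> bool" where
  "late [] x y = False"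
| "late ((a, k) # \<omega>) x y =
     (if a = pos \<omega> y then removed \<omega> x else a \<noteq> pos \<omega> x \<and> late \<omega> x y)"

lemma pos_eq_iff [simp]: "pos \<omega> x = pos \<omega> y \<longleftrightarrow> x = y"
  by (induction \<omega> x rule: pos.induct) auto

text \<open>Consider the last time one of two removed cards was chosen: the other had been removed
  before. One step cannot choose both, as \<open>pos\<close> is injective, so exactly one order
  occurs.\<close>

lemma both_removed:
  "x \<noteq> y \<Longrightarrow> (of_bool (removed \<omega> x \<and> removed \<omega> y) :: real) = of_bool (late \<omega> x y) + of_bool (late \<omega> y x)"
  by (induction \<omega> x rule: removed.induct) auto

section \<open>Averages over sequences of independent uniform steps\<close>

definition steps :: "nat \<Rightarrow> nat \<Rightarrow> (nat \<times> nat) list set" where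
  "steps n t = {\<omega>. length \<omega> = t \<and> set \<omega> \<subseteq> {..<n} \<times> {..<n}}"

definition avg :: "nat \<Rightarrow> nat \<Rightarrow> ((nat \<times> nat) list \<Rightarrow> real) \<Rightarrow> real" where
  "avg n t \<phi> = (\<Sum>\<omega>\<in>steps n t. \<phi> \<omega>) / (real n ^ 2) ^ t"

lemma finite_steps [simp]: "finite (steps n t)"
  unfolding steps_def using finite_lists_length_eq[of "{..<n} \<times> {..<n}" t]
  by (simp add: conj_commute)

lemma pos_less: "\<omega> \<in> steps n t \<Longrightarrow> x < n \<Longrightarrow> pos \<omega> x < n"
proof (induction \<omega> arbitrary: t)
  case (Cons s \<omega>)
  then have "\<omega> \<in> steps n (length \<omega>)" by (auto simp: steps_def)
  with Cons show ?case by (cases s) (auto simp: steps_def intro!: move_less)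
qed auto

lemma steps_Suc: "steps n (Suc t) = (\<lambda>(a, k, \<omega>). (a, k) # \<omega>) ` ({..<n} \<times> {..<n} \<times> steps n t)"
  by (auto simp: steps_def length_Suc_conv image_def)

lemma avg_0 [simp]: "avg n 0 \<phi> = \<phi> []"
proof -
  have "steps n 0 = {[]}" by (auto simp: steps_def)
  then show ?thesis by (simp add: avg_def)
qed

text \<open>Averaging the most recent step first turns the test function into a function of the
  earlier steps; hence inductions on \<open>t\<close> often keep the test function
  arbitrary.\<close>

lemma avg_Suc: "avg n (Suc t) \<phi> = avg n t (\<lambda>\<omega>. (\<Sum>a<n. \<Sum>k<n. \<phi> ((a, k) # \<omega>)) / real n ^ 2)"
proof -
  have "(\<Sum>\<omega>\<in>steps n (Suc t). \<phi> \<omega>) = (\<Sum>(a, k, \<omega>)\<in>{..<n} \<times> {..<n} \<times> steps n t. \<phi> ((a, k) # \<omega>))"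
    unfolding steps_Suc by (subst sum.reindex) (auto simp: inj_on_def intro!: sum.cong)
  also have "\<dots> = (\<Sum>a<n. \<Sum>k<n. \<Sum>\<omega>\<in>steps n t. \<phi> ((a, k) # \<omega>))"
    by (simp add: sum.cartesian_product split_def)
  also have "\<dots> = (\<Sum>a<n. \<Sum>\<omega>\<in>steps n t. \<Sum>k<n. \<phi> ((a, k) # \<omega>))"
    by (intro sum.cong refl sum.swap)
  also have "\<dots> = (\<Sum>\<omega>\<in>steps n t. \<Sum>a<n. \<Sum>k<n. \<phi> ((a, k) # \<omega>))"
    by (rule sum.swap)
  finally show ?thesis by (simp add: avg_def sum_divide_distrib mult.commute)
qed

lemma avg_mono: "(\<And>\<omega>. \<omega> \<in> steps n t \<Longrightarrow> \<phi> \<omega> \<le> \<psi> \<omega>) \<Longrightarrow> avg n t \<phi> \<le> avg n t \<psi>"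
  unfolding avg_def by (intro divide_right_mono sum_mono) auto

lemma avg_cong: "(\<And>\<omega>. \<omega> \<in> steps n t \<Longrightarrow> \<phi> \<omega> = \<psi> \<omega>) \<Longrightarrow> avg n t \<phi> = avg n t \<psi>"
  unfolding avg_def by (simp cong: sum.cong)

lemma avg_add: "avg n t (\<lambda>\<omega>. \<phi> \<omega> + \<psi> \<omega>) = avg n t \<phi> + avg n t \<psi>"
  by (simp add: avg_def sum.distrib add_divide_distrib)

lemma avg_diff: "avg n t (\<lambda>\<omega>. \<phi> \<omega> - \<psi> \<omega>) = avg n t \<phi> - avg n t \<psi>"
  by (simp add: avg_def sum_subtractf diff_divide_distrib)

lemma avg_cmult: "avg n t (\<lambda>\<omega>. c * \<phi> \<omega>) = c * avg n t \<phi>"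
  by (simp add: avg_def sum_distrib_left)

lemma avg_sum: "avg n t (\<lambda>\<omega>. \<Sum>i\<in>I. \<phi> i \<omega>) = (\<Sum>i\<in>I. avg n t (\<phi> i))"
  unfolding avg_def sum_divide_distrib[symmetric] by (simp add: sum.swap[of _ I])

lemma avg_abs: "\<bar>avg n t \<phi>\<bar> \<le> avg n t (\<lambda>\<omega>. \<bar>\<phi> \<omega>\<bar>)"
  unfolding avg_def by (simp add: divide_right_mono sum_abs)

lemma card_steps: "card (steps n t) = (n ^ 2) ^ t"
  unfolding steps_def using card_lists_length_eq[of "{..<n} \<times> {..<n}" t]
  by (simp add: conj_commute power2_eq_square)

lemma avg_const: "0 < n \<Longrightarrow> avg n t (\<lambda>\<omega>. c) = c"
  by (simp add: avg_def card_steps)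

section \<open>Killed evolution and exact uniformity of one removed card\<close>

locale deck =
  fixes n :: nat
  assumes two_le: "2 \<le> n"
begin

lemma n_pos: "0 < n" "real n > 0" "real n \<noteq> 0" "real n \<ge> 2" using two_le by auto

text \<open>The operators \<open>single_op\<close> and \<open>pair_op\<close> are sub-Markov: steps choosing one of the tracked cards
are killed.\<close>

definition single_op :: "(nat \<Rightarrow> real) \<Rightarrow> nat \<Rightarrow> real" where
  "single_op g x = (\<Sum>a\<in>{..<n} - {x}. \<Sum>k<n. g (move a k x)) / real n ^ 2"

definition pair_op :: "(nat \<Rightarrow> nat \<Rightarrow> real) \<Rightarrow> nat \<Rightarrow> nat \<Rightarrow> real" where
  "pair_op G x y = (\<Sum>a\<in>{..<n} - {x, y}. \<Sum>k<n. G (move a k x) (move a k y)) / real n ^ 2"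

definition ins_avg :: "(nat \<Rightarrow> nat \<Rightarrow> real) \<Rightarrow> nat \<Rightarrow> real" where
  "ins_avg G r = (\<Sum>u<n. G (ins u r) u) / real n"

definition pair_mean :: "(nat \<Rightarrow> nat \<Rightarrow> real) \<Rightarrow> real" where
  "pair_mean G = (\<Sum>y<n. \<Sum>x\<in>{..<n} - {y}. G x y) / (real n * (real n - 1))"

definition survival :: "nat \<Rightarrow> real" where
  "survival t = (1 - 1 / real n) ^ t"

lemma survival_bounds: "0 < survival t" "survival t \<le> 1"
  using n_pos by (auto simp: survival_def intro!: power_le_one)

lemma survival_Suc: "survival (Suc t) = (1 - 1 / real n) * survival t"
  by (simp add: survival_def)

text \<open>Every step permutes the positions, so all \<open>a\<close> and \<open>k\<close> together
  give \<open>n^2\<close> copies of the total; the killed terms \<open>a = x\<close> account for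
  \<open>n\<close> of them.\<close>

lemma sum_single_op: "(\<Sum>x<n. single_op g x) = (1 - 1 / real n) * (\<Sum>x<n. g x)"
proof -
  have "(\<Sum>x<n. \<Sum>a\<in>{..<n} - {x}. \<Sum>k<n. g (move a k x)) 
      = (\<Sum>x<n. (\<Sum>a<n. \<Sum>k<n. g (move a k x)) - (\<Sum>k<n. g k))"
    by (intro sum.cong refl) (simp add: sum_diff1)
  also have "\<dots> = (\<Sum>x<n. \<Sum>a<n. \<Sum>k<n. g (move a k x)) - n * (\<Sum>k<n. g k)"
    by (simp add: sum_subtractf)
  also have "(\<Sum>x<n. \<Sum>a<n. \<Sum>k<n. g (move a k x)) = (\<Sum>a<n. \<Sum>x<n. \<Sum>k<n. g (move a k x))"
    by (rule sum.swap)
  also have "\<dots> = (\<Sum>a<n. \<Sum>k<n. \<Sum>x<n. g (move a k x))"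
    by (intro sum.cong refl sum.swap)
  also have "\<dots> = (\<Sum>a<n. \<Sum>k<n. \<Sum>x<n. g x)"
    by (intro sum.cong refl sum_move) auto
  finally show ?thesis using n_pos
    by (simp add: single_op_def sum_divide_distrib[symmetric] field_simps power2_eq_square)
qed

text \<open>Choosing the card makes it uniform, and steps that do not choose it preserve uniformity
  up to the killing factor, by \<open>sum_single_op\<close>.\<close>

lemma avg_removed:
  assumes "x < n"
  shows "avg n t (\<lambda>\<omega>. of_bool (removed \<omega> x) * J (pos \<omega> x)) = (1 - survival t) * (\<Sum>z<n. J z) / real n"
proof (induction t arbitrary: J)
  case (Suc t)
  have "avg n (Suc t) (\<lambda>\<omega>. of_bool (removed \<omega> x) * J (pos \<omega> x))
     = avg n t (\<lambda>\<omega>. (\<Sum>z<n. J z) / real n ^ 2 + of_bool (removed \<omega> x) * single_op J (pos \<omega> x))"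
    unfolding avg_Suc
  proof (rule avg_cong)
    fix \<omega> assume "\<omega> \<in> steps n t"
    then have p: "pos \<omega> x < n" using assms by (rule pos_less)
    have "(\<Sum>a<n. \<Sum>k<n. of_bool (removed ((a, k) # \<omega>) x) * J (pos ((a, k) # \<omega>) x))
       = (\<Sum>z<n. J z) + (\<Sum>a\<in>{..<n} - {pos \<omega> x}. \<Sum>k<n. of_bool (removed \<omega> x) * J (move a k (pos \<omega> x)))"
      using p by (subst sum.remove[of _ "pos \<omega> x"]) (auto intro!: sum.cong)
    then show "(\<Sum>a<n. \<Sum>k<n. of_bool (removed ((a, k) # \<omega>) x) * J (pos ((a, k) # \<omega>) x)) / (real n)\<^sup>2 =
         (\<Sum>z<n. J z) / real n ^ 2 + of_bool (removed \<omega> x) * single_op J (pos \<omega> x)"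
      by (simp add: single_op_def add_divide_distrib sum_distrib_left[symmetric])
  qed
  also have "\<dots> = (\<Sum>z<n. J z) / real n ^ 2 + (1 - survival t) * ((1 - 1 / real n) * (\<Sum>z<n. J z)) / real n"
    using n_pos by (simp add: avg_add avg_const Suc sum_single_op)
  also have "\<dots> = (1 - survival (Suc t)) * (\<Sum>z<n. J z) / real n"
    using n_pos by (simp add: survival_Suc field_simps power2_eq_square)
  finally show ?case .
qed (simp add: survival_def)

lemma avg_unremoved:
  assumes "x < n"
  shows "avg n t (\<lambda>\<omega>. of_bool (\<not> removed \<omega> x)) = survival t"
proof -
  have "avg n t (\<lambda>\<omega>. of_bool (\<not> removed \<omega> x)) = avg n t (\<lambda>\<omega>. 1 - of_bool (removed \<omega> x) * 1)"
    by (rule avg_cong) auto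
  also have "\<dots> = 1 - (1 - survival t) * (\<Sum>z<n. 1) / real n"
    using n_pos by (simp only: avg_diff avg_const avg_removed[OF assms, of t "\<lambda>_. 1"])
  finally show ?thesis using n_pos by simp
qed

lemma avg_unremoved2:
  assumes "x < n" "y < n" "x \<noteq> y"
  shows "avg n t (\<lambda>\<omega>. of_bool (\<not> removed \<omega> x \<and> \<not> removed \<omega> y)) = (1 - 2 / real n) ^ t"
proof (induction t)
  case (Suc t)
  have "avg n (Suc t) (\<lambda>\<omega>. of_bool (\<not> removed \<omega> x \<and> \<not> removed \<omega> y))
     = avg n t (\<lambda>\<omega>. (1 - 2 / real n) * of_bool (\<not> removed \<omega> x \<and> \<not> removed \<omega> y))"
    unfolding avg_Suc
  proof (rule avg_cong)
    fix \<omega> assume w: "\<omega> \<in> steps n t"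
    have "card ({..<n} - {pos \<omega> x, pos \<omega> y}) = n - 2"
      using pos_less[OF w assms(1)] pos_less[OF w assms(2)] assms(3) by (subst card_Diff_subset) auto
    moreover have "(\<Sum>a<n. \<Sum>k<n. of_bool (\<not> removed ((a, k) # \<omega>) x \<and> \<not> removed ((a, k) # \<omega>) y))
       = (\<Sum>a\<in>{..<n} - {pos \<omega> x, pos \<omega> y}. real n * of_bool (\<not> removed \<omega> x \<and> \<not> removed \<omega> y))"
      (is "?lhs = _") by (rule sum.mono_neutral_cong_right) auto
    ultimately have "?lhs = (real n - 2) * (real n * of_bool (\<not> removed \<omega> x \<and> \<not> removed \<omega> y))"
      using two_le by (simp only: sum_constant) (simp add: of_nat_diff)
    also have "\<dots> / real n ^ 2 = (1 - 2 / real n) * of_bool (\<not> removed \<omega> x \<and> \<not> removed \<omega> y)"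
      using n_pos by (simp add: field_simps power2_eq_square)
    finally show "?lhs / real n ^ 2 = (1 - 2 / real n) * of_bool (\<not> removed \<omega> x \<and> \<not> removed \<omega> y)" .
  qed
  then show ?case by (simp add: avg_cmult Suc)
qed simp

end

subsection \<open>Pairs of removed cards\<close>

text \<open>Descending steps telescope to \<open>c 0 - c m\<close>, at most \<open>g\<close>. The
  exceptional step into \<open>u\<close>, if it rises, exceeds its telescoped share by twice its
  height, at most \<open>2 * g\<close>.\<close>

lemma sum_abs_diff_le_antimono_but_one:
  fixes c :: "nat \<Rightarrow> real"
  assumes "\<And>r. r \<le> m \<Longrightarrow> 0 \<le> c r \<and> c r \<le> g"
    and "\<And>r. r < m \<Longrightarrow> Suc r \<noteq> u \<Longrightarrow> c (Suc r) \<le> c r"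
  shows "(\<Sum>r<m. \<bar>c (Suc r) - c r\<bar>) \<le> 3 * g"
proof -
  have "(\<Sum>r<k. \<bar>c (Suc r) - c r\<bar>) \<le> c 0 - c k + (if u \<le> k \<and> 0 < u then 2 * g else 0)" if "k \<le> m" for k
    using that
  proof (induction k)
    case (Suc k)
    have *: "0 \<le> c k" "c k \<le> g" "0 \<le> c (Suc k)" "c (Suc k) \<le> g"
      using assms(1)[of k] assms(1)[of "Suc k"] Suc.prems by auto
    show ?case
    proof (cases "Suc k = u")
      case True
      then show ?thesis using Suc * by (auto simp: abs_if split: if_splits)
    next
      case False
      then have "c (Suc k) \<le> c k" using assms(2)[of k] Suc.prems by auto
      then show ?thesis using Suc * False by (auto simp: abs_if split: if_splits)
    qed
  qed auto
  from this[of m] assms(1)[of 0] assms(1)[of m] show ?thesis by (auto split: if_splits)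
qed

section \<open>Monotone functions of a pair of positions\<close>

context deck
begin

text \<open>Comparisons across \<open>y\<close> are exempt: there the two cards change order, and
  the coupling preserves monotonicity only on one side.\<close>

definition side_antimono :: "(nat \<Rightarrow> nat \<Rightarrow> real) \<Rightarrow> bool" where
  "side_antimono G \<longleftrightarrow> (\<forall>x y. Suc x < n \<longrightarrow> y < n \<longrightarrow> y \<noteq> x \<longrightarrow> y \<noteq> Suc x \<longrightarrow> G (Suc x) y \<le> G x y)"

lemma side_antimonoD:
  assumes "side_antimono G" "x < x'" "x' < n" "y < n" "y < x \<or> x' < y"
  shows "G x' y \<le> G x y"
proof -
  have "y < x \<or> x + d < y \<Longrightarrow> x + d < n \<Longrightarrow> G (x + d) y \<le> G x y" for d
  proof (induction d)
    case (Suc d)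
    have "G (Suc (x + d)) y \<le> G (x + d) y"
      using assms(1,4) Suc.prems by (auto simp: side_antimono_def)
    with Suc show ?case by auto
  qed auto
  from this[of "x' - x"] show ?thesis using assms(2,3,5) by auto
qed

text \<open>Moving a third card keeps the relative order of all the others.\<close>

lemma move_side:
  assumes "y < x \<or> x' < y" "x < x'" "a \<noteq> x" "a \<noteq> x'" "a \<noteq> y"
  shows "move a k x < move a k x' \<and> (move a k y < move a k x \<or> move a k x' < move a k y)"
proof -
  have "move a k u < move a k v" if "u < v" "a \<noteq> u" "a \<noteq> v" for u v
    using that unfolding move_def Let_def by auto
  then show ?thesis using assms by auto
qed

lemma move_swap_adjacent:
  assumes "y \<noteq> x" "y \<noteq> Suc x"
  shows "move (Suc x) k x = move x k (Suc x)" "move (Suc x) k y = move x k y"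
  using assms unfolding move_def Let_def by auto

text \<open>Coupling: compare the deck with the one in which the card at \<open>x + 1\<close> has been exchanged
with its neighbour at \<open>x\<close>. Once the neighbour has been chosen, the two decks agree.\<close>

lemma side_antimono_pair_op:
  assumes "side_antimono G"
  shows "side_antimono (pair_op G)"
  unfolding side_antimono_def
proof (intro allI impI)
  fix x y assume xy: "Suc x < n" "y < n" "y \<noteq> x" "y \<noteq> Suc x"
  define C where "C = {..<n} - {x, Suc x, y}"
  define f where "f z a = (\<Sum>k<n. G (move a k z) (move a k y))" for z a
  have 1: "{..<n} - {x, y} = insert (Suc x) C" "{..<n} - {Suc x, y} = insert x C"
    "finite C" "x \<notin> C" "Suc x \<notin> C"
    using xy by (auto simp: C_def)
  have "f (Suc x) a \<le> f x a" if "a \<in> C" for a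
    unfolding f_def
  proof (rule sum_mono)
    fix k assume "k \<in> {..<n}"
    moreover have "y < x \<or> Suc x < y" using xy by linarith
    ultimately show "G (move a k (Suc x)) (move a k y) \<le> G (move a k x) (move a k y)"
      using that xy move_side[of y x "Suc x" a k]
      by (intro side_antimonoD[OF assms]) (auto simp: C_def move_less)
  qed
  then have "sum (f (Suc x)) C \<le> sum (f x) C"
    by (rule sum_mono)
  moreover have "f (Suc x) x = f x (Suc x)"
    using move_swap_adjacent[of y x] xy by (simp add: f_def)
  ultimately have "sum (f (Suc x)) ({..<n} - {Suc x, y}) \<le> sum (f x) ({..<n} - {x, y})"
    using 1 by simp
  then show "pair_op G (Suc x) y \<le> pair_op G x y"
    by (simp add: pair_op_def f_def divide_right_mono)
qed

text \<open>A uniform rank \<open>r\<close> and a uniform insertion position \<open>u\<close> make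
  \<open>(ins u r, u)\<close> a uniform pair of distinct positions.\<close>

lemma sum_ins_avg: "(\<Sum>r<n - 1. ins_avg G r) = (real n - 1) * pair_mean G"
proof -
  have "(\<Sum>r<n - 1. ins_avg G r) = (\<Sum>u<n. \<Sum>r<n - 1. G (ins u r) u) / real n"
    unfolding ins_avg_def sum_divide_distrib[symmetric] 
    by (rule arg_cong[where f = "\<lambda>s. s / real n"], rule sum.swap)
  also have "(\<Sum>u<n. \<Sum>r<n - 1. G (ins u r) u) = (\<Sum>y<n. \<Sum>x\<in>{..<n} - {y}. G x y)"
  proof (rule sum.cong[OF refl])
    fix u assume "u \<in> {..<n}"
    then show "(\<Sum>r<n - 1. G (ins u r) u) = (\<Sum>x\<in>{..<n} - {u}. G x u)"
      by (intro sum.reindex_bij_betw[of "ins u" _ _ "\<lambda>x. G x u"] bij_betw_ins) auto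
  qed
  finally show ?thesis using n_pos by (simp add: pair_mean_def)
qed

lemma sum_pairs_move:
  assumes "a < n" "k < n"
  shows "(\<Sum>y\<in>{..<n} - {a}. \<Sum>x\<in>{..<n} - {a, y}. G (move a k x) (move a k y))
       = (\<Sum>y\<in>{..<n} - {k}. \<Sum>x\<in>{..<n} - {k, y}. G x y)"
proof -
  have "(\<Sum>x\<in>{..<n} - {a, y}. G (move a k x) (move a k y)) 
      = (\<Sum>x\<in>{..<n} - {k, move a k y}. G x (move a k y))" if "y \<in> {..<n} - {a}" for y
  proof (rule sum.reindex_bij_betw[of "move a k" _ _ "\<lambda>x. G x (move a k y)"])
    show "bij_betw (move a k) ({..<n} - {a, y}) ({..<n} - {k, move a k y})"
      using bij_betw_DiffI[OF bij_betw_move[OF assms], of "{a, y}" "{k, move a k y}"] assms that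
      by (auto simp: bij_betw_def move_less inj_on_def)
  qed
  then have "(\<Sum>y\<in>{..<n} - {a}. \<Sum>x\<in>{..<n} - {a, y}. G (move a k x) (move a k y))
     = (\<Sum>y\<in>{..<n} - {a}. \<Sum>x\<in>{..<n} - {k, move a k y}. G x (move a k y))"
    by (rule sum.cong[OF refl])
  also have "\<dots> = (\<Sum>y\<in>{..<n} - {k}. \<Sum>x\<in>{..<n} - {k, y}. G x y)"
    by (rule sum.reindex_bij_betw[OF bij_betw_move_remove[OF assms], 
          of "\<lambda>y. \<Sum>x\<in>{..<n} - {k, y}. G x y"])
  finally show ?thesis .
qed

text \<open>Both sides run over triples of distinct positions. With \<open>a\<close> outermost,
  \<open>sum_pairs_move\<close> can trade the vacated position for \<open>k\<close>.\<close>

lemma sum_pairs_remove: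
  "(\<Sum>y<n. \<Sum>x\<in>{..<n} - {y}. \<Sum>a\<in>{..<n} - {x, y}. f a x y)
     = (\<Sum>a<n. \<Sum>y\<in>{..<n} - {a}. \<Sum>x\<in>{..<n} - {a, y}. (f a x y :: real))"
proof -
  have "(\<Sum>y<n. \<Sum>x\<in>{..<n} - {y}. \<Sum>a\<in>{..<n} - {x, y}. f a x y)
      = (\<Sum>(y, x, a)\<in>(SIGMA y:{..<n}. SIGMA x:{..<n} - {y}. {..<n} - {x, y}). f a x y)"
    by (simp add: sum.Sigma)
  also have "\<dots> = (\<Sum>(a, y, x)\<in>(SIGMA a:{..<n}. SIGMA y:{..<n} - {a}. {..<n} - {a, y}). f a x y)"
    by (rule sum.reindex_bij_witness[of _ "\<lambda>(a, y, x). (y, x, a)" "\<lambda>(y, x, a). (a, y, x)"]) auto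
  also have "\<dots> = (\<Sum>a<n. \<Sum>y\<in>{..<n} - {a}. \<Sum>x\<in>{..<n} - {a, y}. f a x y)"
    by (simp add: sum.Sigma)
  finally show ?thesis .
qed

text \<open>A step avoiding both cards carries uniform distinct pairs off \<open>a\<close> to
  uniform distinct pairs off \<open>k\<close>; two of the \<open>n\<close> choices of
  \<open>a\<close> are killed.\<close>

lemma pair_mean_pair_op: "pair_mean (pair_op G) = (1 - 2 / real n) * pair_mean G"
proof -
  define S where "S = (\<Sum>y<n. \<Sum>x\<in>{..<n} - {y}. G x y)"
  have "(\<Sum>y<n. \<Sum>x\<in>{..<n} - {y}. \<Sum>a\<in>{..<n} - {x, y}. \<Sum>k<n. G (move a k x) (move a k y))
     = (\<Sum>a<n. \<Sum>y\<in>{..<n} - {a}. \<Sum>x\<in>{..<n} - {a, y}. \<Sum>k<n. G (move a k x) (move a k y))"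
    by (rule sum_pairs_remove)
  also have "\<dots> = (\<Sum>a<n. \<Sum>y\<in>{..<n} - {a}. \<Sum>k<n. \<Sum>x\<in>{..<n} - {a, y}. G (move a k x) (move a k y))"
    by (intro sum.cong refl sum.swap)
  also have "\<dots> = (\<Sum>a<n. \<Sum>k<n. \<Sum>y\<in>{..<n} - {a}. \<Sum>x\<in>{..<n} - {a, y}. G (move a k x) (move a k y))"
    by (intro sum.cong refl sum.swap)
  also have "\<dots> = (\<Sum>a<n. \<Sum>k<n. \<Sum>y\<in>{..<n} - {k}. \<Sum>x\<in>{..<n} - {k, y}. G x y)"
    by (intro sum.cong refl sum_pairs_move) auto
  also have "\<dots> = real n * (\<Sum>k<n. \<Sum>y\<in>{..<n} - {k}. \<Sum>x\<in>{..<n} - {k, y}. G x y)"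
    by simp
  also have "(\<Sum>k<n. \<Sum>y\<in>{..<n} - {k}. \<Sum>x\<in>{..<n} - {k, y}. G x y)
     = (\<Sum>y<n. \<Sum>x\<in>{..<n} - {y}. \<Sum>a\<in>{..<n} - {x, y}. G x y)"
    by (rule sum_pairs_remove[symmetric])
  also have "\<dots> = (\<Sum>y<n. \<Sum>x\<in>{..<n} - {y}. (real n - 2) * G x y)"
  proof (intro sum.cong refl)
    fix x y assume "y \<in> {..<n}" "x \<in> {..<n} - {y}"
    then have "card ({..<n} - {x, y}) = n - 2" by (subst card_Diff_subset) auto
    then show "(\<Sum>a\<in>{..<n} - {x, y}. G x y) = (real n - 2) * G x y"
      using two_le by (simp add: of_nat_diff)
  qed
  also have "\<dots> = (real n - 2) * S"
    by (simp add: S_def sum_distrib_left)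
  finally have "pair_mean (pair_op G) = real n * ((real n - 2) * S) / real n ^ 2 / (real n * (real n - 1))"
    by (simp add: pair_mean_def pair_op_def sum_divide_distrib[symmetric])
  also have "\<dots> = (1 - 2 / real n) * (S / (real n * (real n - 1)))"
    using n_pos by (simp add: field_simps power2_eq_square)
  finally show ?thesis by (simp add: pair_mean_def S_def)
qed

section \<open>Dependence on the rank and approximate uniformity of pairs\<close>

lemma ins_avg_bounds:
  assumes "\<And>x y. x < n \<Longrightarrow> y < n \<Longrightarrow> 0 \<le> G x y \<and> G x y \<le> \<gamma> y" "r < n - 1"
  shows "0 \<le> ins_avg G r" "ins_avg G r \<le> (\<Sum>y<n. \<gamma> y) / real n"
proof -
  have "ins u r < n" if "u < n" for u using assms(2) by (auto simp: ins_def)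
  then show "0 \<le> ins_avg G r" "ins_avg G r \<le> (\<Sum>y<n. \<gamma> y) / real n"
    using assms(1) by (auto simp: ins_avg_def intro!: divide_right_mono divide_nonneg_nonneg sum_mono sum_nonneg)
qed

text \<open>For fixed \<open>u\<close>, the value \<open>G (ins u r) u\<close> is decreasing in
  \<open>r\<close> except from \<open>u - 1\<close> to \<open>u\<close>, where the position of
  \<open>x\<close> jumps over \<open>u\<close>. This is the exception allowed in
  \<open>sum_abs_diff_le_antimono_but_one\<close>.\<close>

lemma ins_avg_variation:
  assumes "side_antimono G"
    and G: "\<And>x y. x < n \<Longrightarrow> y < n \<Longrightarrow> 0 \<le> G x y \<and> G x y \<le> \<gamma> y"
  shows "(\<Sum>r<n - 2. \<bar>ins_avg G (Suc r) - ins_avg G r\<bar>) \<le> 3 * (\<Sum>y<n. \<gamma> y) / real n"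
proof -
  have "(\<Sum>r<n - 2. \<bar>ins_avg G (Suc r) - ins_avg G r\<bar>)
      \<le> (\<Sum>r<n - 2. (\<Sum>u<n. \<bar>G (ins u (Suc r)) u - G (ins u r) u\<bar>) / real n)"
  proof (rule sum_mono)
    fix r
    have "\<bar>ins_avg G (Suc r) - ins_avg G r\<bar> = \<bar>\<Sum>u<n. G (ins u (Suc r)) u - G (ins u r) u\<bar> / real n"
      using n_pos by (simp add: ins_avg_def sum_subtractf diff_divide_distrib[symmetric])
    also have "\<dots> \<le> (\<Sum>u<n. \<bar>G (ins u (Suc r)) u - G (ins u r) u\<bar>) / real n"
      by (intro divide_right_mono sum_abs) auto
    finally show "\<bar>ins_avg G (Suc r) - ins_avg G r\<bar> \<le> \<dots>" .
  qed
  also have "\<dots> = (\<Sum>u<n. \<Sum>r<n - 2. \<bar>G (ins u (Suc r)) u - G (ins u r) u\<bar>) / real n"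
    unfolding sum_divide_distrib[symmetric]
    by (rule arg_cong[where f = "\<lambda>s. s / real n"], rule sum.swap)
  also have "\<dots> \<le> (\<Sum>u<n. 3 * \<gamma> u) / real n"
  proof (intro divide_right_mono sum_mono)
    fix u assume "u \<in> {..<n}"
    then show "(\<Sum>r<n - 2. \<bar>G (ins u (Suc r)) u - G (ins u r) u\<bar>) \<le> 3 * \<gamma> u"
      by (intro sum_abs_diff_le_antimono_but_one[where u = u])
         (use two_le in \<open>auto simp: ins_def intro!: G side_antimonoD[OF assms(1)]\<close>)
  qed auto
  finally show ?thesis by (simp add: sum_distrib_left)
qed

text \<open>The rank of \<open>x\<close> in the deck without \<open>y\<close> differs by at most one from the position of \<open>x\<close>,
which is uniform after a removal; hence the variation of \<open>ins_avg G\<close> controls the error.\<close>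

lemma avg_removed_ins_avg:
  assumes "side_antimono G"
    and G: "\<And>x y. x < n \<Longrightarrow> y < n \<Longrightarrow> 0 \<le> G x y \<and> G x y \<le> \<gamma> y"
    and xy: "x < n" "y < n" "x \<noteq> y"
  shows "\<bar>avg n t (\<lambda>\<omega>. of_bool (removed \<omega> x) *
            ins_avg G (if pos \<omega> y < pos \<omega> x then pos \<omega> x - 1 else pos \<omega> x))
          - (1 - survival t) * pair_mean G\<bar> \<le> 4 * (\<Sum>y<n. \<gamma> y) / real n ^ 2"
proof -
  define s where "s = (\<Sum>y<n. \<gamma> y)"
  \<comment> \<open>A position \<open>z\<close> is read as a rank. The top position
    \<open>n - 1\<close> is not a rank; the value \<open>pair_mean G\<close> there makes the uniform
    average of \<open>J\<close> exactly \<open>pair_mean G\<close>.\<close>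
  define J where "J z = (if z < n - 1 then ins_avg G z else pair_mean G)" for z
  \<comment> \<open>If \<open>y\<close> lies below \<open>x\<close>, the rank is
    \<open>z - 1\<close>, and \<open>z = 0\<close> cannot occur; otherwise the rank is
    \<open>z\<close> and \<open>J\<close> is exact.\<close>
  define D where "D z = (if z = 0 then 0 else \<bar>J z - ins_avg G (z - 1)\<bar>)" for z
  have n1: "n = Suc (n - 1)" "n - 1 = Suc (n - 2)" using two_le by auto
  have sJ: "(\<Sum>z<n. J z) = real n * pair_mean G"
  proof -
    have "(\<Sum>z<n. J z) = (\<Sum>z<n - 1. J z) + pair_mean G" by (subst n1(1)) (simp add: J_def)
    also have "(\<Sum>z<n - 1. J z) = (\<Sum>z<n - 1. ins_avg G z)" by (intro sum.cong) (auto simp: J_def)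
    finally show ?thesis unfolding sum_ins_avg by (simp add: algebra_simps)
  qed
  have Hb: "0 \<le> ins_avg G r" "ins_avg G r \<le> s / real n" if "r < n - 1" for r
    using ins_avg_bounds[OF G that] by (auto simp: s_def)
  have Ub: "0 \<le> pair_mean G" "pair_mean G \<le> s / real n"
  proof -
    have "0 \<le> (real n - 1) * pair_mean G" unfolding sum_ins_avg[symmetric] using Hb by (intro sum_nonneg) auto
    then show "0 \<le> pair_mean G" using n_pos by (simp add: zero_le_mult_iff)
    have "(real n - 1) * pair_mean G \<le> (\<Sum>r<n - 1. s / real n)" 
      unfolding sum_ins_avg[symmetric] using Hb by (intro sum_mono) auto
    also have "\<dots> = (real n - 1) * (s / real n)" using two_le by (simp add: of_nat_diff)
    finally show "pair_mean G \<le> s / real n" using n_pos(4) by (simp only: mult_le_cancel_left_pos)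
  qed
  \<comment> \<open>All but the last term form the variation of \<open>ins_avg G\<close>; the last
    compares two numbers between 0 and \<open>s / n\<close>. Hence 4 = 3 + 1.\<close>
  have "(\<Sum>z<n. D z) = (\<Sum>z<n - 1. D (Suc z))"
    by (subst n1(1), subst sum.lessThan_Suc_shift) (simp add: D_def)
  also have "\<dots> = (\<Sum>z<n - 2. D (Suc z)) + D (n - 1)"
    unfolding n1(2) by simp
  also have "(\<Sum>z<n - 2. D (Suc z)) = (\<Sum>r<n - 2. \<bar>ins_avg G (Suc r) - ins_avg G r\<bar>)"
    by (intro sum.cong) (auto simp: D_def J_def)
  also have "\<dots> \<le> 3 * s / real n"
    unfolding s_def by (rule ins_avg_variation[OF assms(1) G])
  also have "D (n - 1) \<le> s / real n"
  proof -
    have "0 \<le> ins_avg G (n - 2)" "ins_avg G (n - 2) \<le> s / real n" using Hb[of "n - 2"] two_le by auto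
    then show ?thesis using Ub two_le by (auto simp: D_def J_def abs_le_iff numeral_2_eq_2)
  qed
  finally have sD: "(\<Sum>z<n. D z) \<le> 4 * s / real n" by simp
  let ?r = "\<lambda>\<omega>. if pos \<omega> y < pos \<omega> x then pos \<omega> x - 1 else pos \<omega> x"
  have "\<bar>avg n t (\<lambda>\<omega>. of_bool (removed \<omega> x) * ins_avg G (?r \<omega>)) - (1 - survival t) * pair_mean G\<bar>
     = \<bar>avg n t (\<lambda>\<omega>. of_bool (removed \<omega> x) * ins_avg G (?r \<omega>) - of_bool (removed \<omega> x) * J (pos \<omega> x))\<bar>"
    using n_pos by (simp add: avg_diff avg_removed[OF xy(1)] sJ)
  also have "\<dots> \<le> avg n t (\<lambda>\<omega>. \<bar>of_bool (removed \<omega> x) * ins_avg G (?r \<omega>) - of_bool (removed \<omega> x) * J (pos \<omega> x)\<bar>)"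
    by (rule avg_abs)
  also have "\<dots> \<le> avg n t (\<lambda>\<omega>. of_bool (removed \<omega> x) * D (pos \<omega> x))"
  proof (rule avg_mono)
    fix \<omega> assume w: "\<omega> \<in> steps n t"
    have p: "pos \<omega> x < n" "pos \<omega> y < n" "pos \<omega> x \<noteq> pos \<omega> y" using pos_less[OF w] xy by auto
    then have "pos \<omega> y < pos \<omega> x \<or> pos \<omega> x < n - 1" by linarith
    then show "\<bar>of_bool (removed \<omega> x) * ins_avg G (?r \<omega>) - of_bool (removed \<omega> x) * J (pos \<omega> x)\<bar>
       \<le> of_bool (removed \<omega> x) * D (pos \<omega> x)"
      using p by (auto simp: D_def J_def)
  qed
  also have "\<dots> = (1 - survival t) * (\<Sum>z<n. D z) / real n"
    by (rule avg_removed[OF xy(1)])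
  also have "\<dots> \<le> 1 * (4 * s / real n) / real n"
    using survival_bounds[of t] sD by (intro divide_right_mono mult_mono sum_nonneg) (auto simp: D_def)
  finally show ?thesis by (simp add: s_def power2_eq_square)
qed

text \<open>The most recent step either avoids both cards, or chooses \<open>y\<close> after
  \<open>x\<close> was removed; then \<open>y\<close> becomes uniform while the rank of
  \<open>x\<close> among the other cards is unchanged. Choosing \<open>x\<close> destroys
  lateness.\<close>

lemma avg_late_Suc:
  assumes xy: "x < n" "y < n" "x \<noteq> y"
  shows "avg n (Suc t) (\<lambda>\<omega>. of_bool (late \<omega> x y) * G (pos \<omega> x) (pos \<omega> y))
    = avg n t (\<lambda>\<omega>. of_bool (late \<omega> x y) * pair_op G (pos \<omega> x) (pos \<omega> y))
    + avg n t (\<lambda>\<omega>. of_bool (removed \<omega> x) *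
            ins_avg G (if pos \<omega> y < pos \<omega> x then pos \<omega> x - 1 else pos \<omega> x)) / real n"
proof -
  let ?r = "\<lambda>\<omega>. if pos \<omega> y < pos \<omega> x then pos \<omega> x - 1 else pos \<omega> x"
  have "avg n (Suc t) (\<lambda>\<omega>. of_bool (late \<omega> x y) * G (pos \<omega> x) (pos \<omega> y))
    = avg n t (\<lambda>\<omega>. of_bool (late \<omega> x y) * pair_op G (pos \<omega> x) (pos \<omega> y) + 
         (1 / real n) * (of_bool (removed \<omega> x) * ins_avg G (?r \<omega>)))"
    unfolding avg_Suc
  proof (rule avg_cong)
    fix \<omega> assume w: "\<omega> \<in> steps n t"
    define X Y where "X = pos \<omega> x" and "Y = pos \<omega> y"
    have p: "X < n" "Y < n" "X \<noteq> Y" using pos_less[OF w] xy by (auto simp: X_def Y_def)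
    define f where "f a = (\<Sum>k<n. of_bool (late ((a, k) # \<omega>) x y) * 
       G (pos ((a, k) # \<omega>) x) (pos ((a, k) # \<omega>) y))" for a
    have "(\<Sum>a<n. f a) = f Y + (\<Sum>a\<in>{..<n} - {Y}. f a)"
      using p by (subst sum.remove[of _ Y]) auto
    also have "(\<Sum>a\<in>{..<n} - {Y}. f a) = (\<Sum>a\<in>{..<n} - {X, Y}. f a)"
      by (rule sum.mono_neutral_right) (auto simp: f_def X_def Y_def)
    also have "\<dots> = of_bool (late \<omega> x y) * (\<Sum>a\<in>{..<n} - {X, Y}. \<Sum>k<n. G (move a k X) (move a k Y))"
      unfolding sum_distrib_left by (intro sum.cong refl) (auto simp: f_def X_def Y_def)
    also have "f Y = of_bool (removed \<omega> x) * (\<Sum>u<n. G (ins u (?r \<omega>)) u)"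
      using p by (simp add: f_def X_def[symmetric] Y_def[symmetric] move_conv_ins sum_distrib_left)
    finally show "(\<Sum>a<n. \<Sum>k<n. of_bool (late ((a, k) # \<omega>) x y) * 
       G (pos ((a, k) # \<omega>) x) (pos ((a, k) # \<omega>) y)) / real n ^ 2 =
       of_bool (late \<omega> x y) * pair_op G (pos \<omega> x) (pos \<omega> y) + 
         (1 / real n) * (of_bool (removed \<omega> x) * ins_avg G (?r \<omega>))"
      using n_pos by (simp add: f_def pair_op_def ins_avg_def X_def Y_def power2_eq_square field_simps)
  qed
  also have "\<dots> = avg n t (\<lambda>\<omega>. of_bool (late \<omega> x y) * pair_op G (pos \<omega> x) (pos \<omega> y)) +
      avg n t (\<lambda>\<omega>. of_bool (removed \<omega> x) * ins_avg G (?r \<omega>)) / real n"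
    unfolding avg_add avg_cmult by simp
  finally show ?thesis .
qed

text \<open>Keeps the domination hypothesis of \<open>late_approx\<close> alive along the induction;
  the added terms \<open>a = x\<close> are nonnegative.\<close>

lemma pair_op_le_single_op:
  assumes "\<And>x y. x < n \<Longrightarrow> y < n \<Longrightarrow> 0 \<le> G x y \<and> G x y \<le> \<gamma> y" "x < n" "y < n"
  shows "0 \<le> pair_op G x y \<and> pair_op G x y \<le> single_op \<gamma> y"
proof
  show "0 \<le> pair_op G x y"
    using assms by (auto simp: pair_op_def move_less intro!: divide_nonneg_nonneg sum_nonneg)
  have "(\<Sum>a\<in>{..<n} - {x, y}. \<Sum>k<n. G (move a k x) (move a k y)) 
     \<le> (\<Sum>a\<in>{..<n} - {x, y}. \<Sum>k<n. \<gamma> (move a k y))"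
    using assms by (intro sum_mono) (auto simp: move_less)
  also have "\<dots> \<le> (\<Sum>a\<in>{..<n} - {y}. \<Sum>k<n. \<gamma> (move a k y))"
  proof (rule sum_mono2)
    have "0 \<le> \<gamma> z" if "z < n" for z
      using assms(1)[OF that that] by linarith
    then show "0 \<le> (\<Sum>k<n. \<gamma> (move a k y))" if "a \<in> {..<n} - {y} - ({..<n} - {x, y})" for a
      using that assms(3) by (intro sum_nonneg) (auto simp: move_less)
  qed auto
  finally show "pair_op G x y \<le> single_op \<gamma> y"
    by (simp add: single_op_def pair_op_def divide_right_mono)
qed

text \<open>The recursion of \<open>avg_late_Suc\<close> for constant \<open>G = 1\<close>: the
  probability of \<open>late\<close> for two distinct cards.\<close>

primrec late_prob :: "nat \<Rightarrow> real" where
  "late_prob 0 = 0"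
| "late_prob (Suc t) = (1 - 2 / real n) * late_prob t + (1 - survival t) / real n"

lemma late_prob_bounds: "0 \<le> late_prob t \<and> late_prob t \<le> 1"
proof (induction t)
  case (Suc t)
  have "(1 - 2 / real n) * late_prob t \<le> (1 - 2 / real n) * 1"
    using Suc n_pos by (intro mult_left_mono) auto
  moreover have "(1 - survival t) / real n \<le> 1 / real n"
    using survival_bounds[of t] by (intro divide_right_mono) auto
  moreover have "0 \<le> (1 - 2 / real n) * late_prob t" "0 \<le> (1 - survival t) / real n"
    using Suc n_pos survival_bounds[of t] by auto
  ultimately show ?case using n_pos by auto
qed auto

text \<open>Each step adds an error of at most \<open>s / n\<close> by
  \<open>avg_removed_ins_avg\<close>. Older errors are those of \<open>pair_op G\<close>, dominated
  by \<open>single_op \<gamma>\<close>, whose total is smaller by the factor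
  \<open>1 - 1 / n\<close>. This geometric series stays bounded in \<open>t\<close>.\<close>

lemma late_approx:
  assumes "side_antimono G"
    and "\<And>x y. x < n \<Longrightarrow> y < n \<Longrightarrow> 0 \<le> G x y \<and> G x y \<le> \<gamma> y"
    and xy: "x < n" "y < n" "x \<noteq> y"
  shows "\<bar>avg n t (\<lambda>\<omega>. of_bool (late \<omega> x y) * G (pos \<omega> x) (pos \<omega> y)) - late_prob t * pair_mean G\<bar>
     \<le> 4 * (\<Sum>y<n. \<gamma> y) / real n ^ 2 * (1 - survival t)"
  using assms(1,2)
proof (induction t arbitrary: G \<gamma>)
  case (Suc t)
  define s where "s = 4 * (\<Sum>y<n. \<gamma> y) / real n ^ 2"
  let ?A = "avg n t (\<lambda>\<omega>. of_bool (late \<omega> x y) * pair_op G (pos \<omega> x) (pos \<omega> y))"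
  let ?B = "avg n t (\<lambda>\<omega>. of_bool (removed \<omega> x) *
            ins_avg G (if pos \<omega> y < pos \<omega> x then pos \<omega> x - 1 else pos \<omega> x))"
  have "\<bar>?A - late_prob t * pair_mean (pair_op G)\<bar> \<le> 4 * (\<Sum>y<n. single_op \<gamma> y) / real n ^ 2 * (1 - survival t)"
    by (rule Suc.IH) (use pair_op_le_single_op[OF Suc.prems(2)] side_antimono_pair_op[OF Suc.prems(1)] in auto)
  also have "\<dots> = (1 - 1 / real n) * s * (1 - survival t)"
    by (simp add: sum_single_op s_def)
  finally have A: "\<bar>?A - late_prob t * ((1 - 2 / real n) * pair_mean G)\<bar> \<le> (1 - 1 / real n) * s * (1 - survival t)"
    by (simp add: pair_mean_pair_op)
  have "\<bar>?B - (1 - survival t) * pair_mean G\<bar> / real n \<le> s / real n"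
    using avg_removed_ins_avg[OF Suc.prems xy] by (intro divide_right_mono) (auto simp: s_def)
  then have B: "\<bar>?B / real n - (1 - survival t) * pair_mean G / real n\<bar> \<le> s / real n"
    by (simp add: diff_divide_distrib[symmetric])
  have "avg n (Suc t) (\<lambda>\<omega>. of_bool (late \<omega> x y) * G (pos \<omega> x) (pos \<omega> y)) - late_prob (Suc t) * pair_mean G
     = (?A - late_prob t * ((1 - 2 / real n) * pair_mean G)) + (?B / real n - (1 - survival t) * pair_mean G / real n)"
    by (simp add: avg_late_Suc[OF xy] algebra_simps add_divide_distrib diff_divide_distrib)
  also have "\<bar>\<dots>\<bar> \<le> (1 - 1 / real n) * s * (1 - survival t) + s / real n"
    using A B by linarith
  also have "\<dots> = s * (1 - survival (Suc t))"
    using n_pos by (simp add: survival_Suc field_simps)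
  finally show ?case by (simp add: s_def)
qed (auto simp: survival_def)

end

subsection \<open>Displacement of unremoved cards and the window statistic\<close>

lemma sum_of_bool_atMost: "z < n \<Longrightarrow> (\<Sum>k<n. of_bool (k \<le> z)) = real z + 1"
proof -
  assume "z < n"
  then have "{..<n} \<inter> {k. k \<le> z} = {..z}" by auto
  then show ?thesis by simp
qed

lemma sum_of_bool_atLeast: "z < n \<Longrightarrow> (\<Sum>k<n. of_bool (z \<le> k)) = real n - real z"
proof -
  assume "z < n"
  then have "{..<n} \<inter> {k. z \<le> k} = {z..<n}" by auto
  then show ?thesis using \<open>z < n\<close> by (simp add: of_nat_diff)
qed

context deck
begin

text \<open>An unchosen card moves by at most one, with killed mean displacement
  \<open>(n - 1 - 2 * z) / n^2\<close>. Times twice the distance \<open>d\<close>, itself at most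
  \<open>n\<close>, this drift costs at most 2; the squared unit jumps cost at most 1.\<close>

lemma single_op_sq_dist:
  assumes z: "z < n" and x: "0 \<le> x" "x \<le> real n"
  shows "single_op (\<lambda>y. (real y - x)\<^sup>2) z \<le> (1 - 1 / real n) * (real z - x)\<^sup>2 + 3"
proof -
  define d where "d = real z - x"
  define f where "f a = (\<Sum>k<n. (real (move a k z) - x)\<^sup>2)" for a
  have up: "f a = real n * d\<^sup>2 + (real z + 1) * (2 * d + 1)" if "z < a" for a
  proof -
    have "f a = (\<Sum>k<n. d\<^sup>2 + of_bool (k \<le> z) * (2 * d + 1))"
      unfolding f_def using that
      by (intro sum.cong refl) (auto simp: move_def d_def power2_eq_square algebra_simps)
    then show ?thesis
      by (simp only: sum.distrib sum_distrib_right[symmetric] sum_of_bool_atMost[OF z]) simp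
  qed
  have down: "f a = real n * d\<^sup>2 + (real n - real z) * (1 - 2 * d)" if "a < z" for a
  proof -
    have "move a k z = (if z \<le> k then z - 1 else z)" for k
      using that by (auto simp: move_def Let_def)
    then have "f a = (\<Sum>k<n. d\<^sup>2 + of_bool (z \<le> k) * (1 - 2 * d))"
      unfolding f_def using that
      by (intro sum.cong refl) (auto simp: d_def power2_eq_square algebra_simps of_nat_diff)
    then show ?thesis
      by (simp only: sum.distrib sum_distrib_right[symmetric] sum_of_bool_atLeast[OF z]) simp
  qed
  have split: "{..<n} - {z} = {..<z} \<union> {Suc z..<n}" using z by auto
  have "sum f ({..<n} - {z}) = sum f {..<z} + sum f {Suc z..<n}"
    unfolding split by (rule sum.union_disjoint) auto
  also have "\<dots> = real z * (real n * d\<^sup>2 + (real n - real z) * (1 - 2 * d))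
      + (real n - 1 - real z) * (real n * d\<^sup>2 + (real z + 1) * (2 * d + 1))"
    using z by (simp add: up down of_nat_diff)
  also have "\<dots> = real n * (real n - 1) * d\<^sup>2 + 2 * (d * (real n - 1 - 2 * real z))
     + (real z * (real n - real z) + (real n - 1 - real z) * (real z + 1))"
    by (simp add: algebra_simps power2_eq_square)
  also have "d * (real n - 1 - 2 * real z) \<le> \<bar>d\<bar> * \<bar>real n - 1 - 2 * real z\<bar>"
    by (metis abs_ge_self abs_mult)
  also have "\<dots> \<le> real n * real n"
    using z x by (intro mult_mono) (auto simp: d_def)
  also have "real z * (real n - real z) \<le> real z * real n"
    by (intro mult_left_mono) auto
  also have "(real n - 1 - real z) * (real z + 1) \<le> (real n - 1 - real z) * real n"
    using z by (intro mult_left_mono) auto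
  finally have "sum f ({..<n} - {z}) \<le> real n * (real n - 1) * d\<^sup>2 + 3 * (real n)\<^sup>2"
    using z by (simp add: algebra_simps power2_eq_square)
  then have "sum f ({..<n} - {z}) / (real n)\<^sup>2 \<le> (real n * (real n - 1) * d\<^sup>2 + 3 * (real n)\<^sup>2) / (real n)\<^sup>2"
    by (intro divide_right_mono) auto
  also have "\<dots> = (1 - 1 / real n) * d\<^sup>2 + 3"
    using n_pos by (simp add: field_simps power2_eq_square)
  finally show ?thesis by (simp add: single_op_def f_def d_def)
qed

lemma avg_displacement:
  assumes "x < n"
  shows "avg n t (\<lambda>\<omega>. of_bool (\<not> removed \<omega> x) * (real (pos \<omega> x) - real x)\<^sup>2) \<le> 6 * real t * survival t"
proof (induction t)
  case (Suc t)
  let ?h = "\<lambda>y. (real y - real x)\<^sup>2"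
  have "avg n (Suc t) (\<lambda>\<omega>. of_bool (\<not> removed \<omega> x) * ?h (pos \<omega> x))
      = avg n t (\<lambda>\<omega>. of_bool (\<not> removed \<omega> x) * single_op ?h (pos \<omega> x))"
    unfolding avg_Suc
  proof (rule avg_cong)
    fix \<omega> assume "\<omega> \<in> steps n t"
    then have p: "pos \<omega> x < n" using assms by (rule pos_less)
    have "(\<Sum>a<n. \<Sum>k<n. of_bool (\<not> removed ((a, k) # \<omega>) x) * ?h (pos ((a, k) # \<omega>) x))
       = (\<Sum>a\<in>{..<n} - {pos \<omega> x}. \<Sum>k<n. of_bool (\<not> removed \<omega> x) * ?h (move a k (pos \<omega> x)))"
      by (rule sum.mono_neutral_cong_right) auto
    then show "(\<Sum>a<n. \<Sum>k<n. of_bool (\<not> removed ((a, k) # \<omega>) x) * ?h (pos ((a, k) # \<omega>) x)) / (real n)\<^sup>2 =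
         of_bool (\<not> removed \<omega> x) * single_op ?h (pos \<omega> x)"
      by (simp add: single_op_def sum_distrib_left[symmetric])
  qed
  also have "\<dots> \<le> avg n t (\<lambda>\<omega>. (1 - 1 / real n) * (of_bool (\<not> removed \<omega> x) * ?h (pos \<omega> x)) 
                              + 3 * of_bool (\<not> removed \<omega> x))"
  proof (rule avg_mono)
    fix \<omega> assume "\<omega> \<in> steps n t"
    then have p: "pos \<omega> x < n" using assms by (rule pos_less)
    show "of_bool (\<not> removed \<omega> x) * single_op ?h (pos \<omega> x) \<le> 
      (1 - 1 / real n) * (of_bool (\<not> removed \<omega> x) * ?h (pos \<omega> x)) + 3 * of_bool (\<not> removed \<omega> x)"
      using single_op_sq_dist[OF p, of "real x"] assms by auto
  qed
  also have "\<dots> = (1 - 1 / real n) * avg n t (\<lambda>\<omega>. of_bool (\<not> removed \<omega> x) * ?h (pos \<omega> x)) + 3 * survival t"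
    by (simp add: avg_add avg_cmult avg_unremoved[OF assms])
  also have "\<dots> \<le> (1 - 1 / real n) * (6 * real t * survival t) + 3 * survival t"
    using Suc n_pos by (intro add_mono mult_left_mono) auto
  \<comment> \<open>\<open>1 - 1 / n\<close> is at least \<open>1 / 2\<close>, so doubling 3 pays
    for the extra factor in \<open>survival (Suc t)\<close>.\<close>
  also have "3 * survival t \<le> 6 * (1 - 1 / real n) * survival t"
    using n_pos survival_bounds[of t] by (intro mult_right_mono) (auto simp: field_simps)
  finally show ?case by (simp add: survival_Suc algebra_simps)
qed auto

section \<open>The centred window function and its moments\<close>

definition near :: "nat \<Rightarrow> nat \<Rightarrow> nat \<Rightarrow> bool" where
  "near w x z \<longleftrightarrow> z \<le> x + w \<and> x \<le> z + w"

definition near_mean :: "nat \<Rightarrow> nat \<Rightarrow> real" where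
  "near_mean w x = (\<Sum>z<n. of_bool (near w x z)) / real n"

definition window :: "nat \<Rightarrow> nat \<Rightarrow> nat \<Rightarrow> real" where
  "window w x z = of_bool (near w x z) - near_mean w x"

definition width :: "nat \<Rightarrow> real" where
  "width w = 2 * real w + 1"

lemma sum_near: "(\<Sum>z<n. of_bool (near w x z)) \<le> width w"
proof -
  have "card ({..<n} \<inter> {z. near w x z}) \<le> card {x - w..x + w}"
    by (intro card_mono) (auto simp: near_def)
  also have "\<dots> \<le> 2 * w + 1" by auto
  finally show ?thesis by (simp add: width_def)
qed

lemma near_mean_bounds: "0 \<le> near_mean w x" "near_mean w x \<le> 1" "real n * near_mean w x \<le> width w"
proof -
  show "0 \<le> near_mean w x" by (simp add: near_mean_def)
  have "(\<Sum>z<n. of_bool (near w x z)) \<le> (\<Sum>z<n. 1 :: real)" by (intro sum_mono) auto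
  then show "near_mean w x \<le> 1" using n_pos by (simp only: near_mean_def) (simp add: field_simps)
  show "real n * near_mean w x \<le> width w" using n_pos sum_near[of w x] by (simp add: near_mean_def)
qed

lemma width_pos: "width w > 0" by (simp add: width_def)

lemma sum_near_eq: "(\<Sum>z<n. of_bool (near w x z)) = real n * near_mean w x"
  using n_pos by (simp add: near_mean_def)

lemma sum_window: "(\<Sum>z<n. window w x z) = 0"
  by (simp only: window_def sum_subtractf sum_near_eq) simp

lemma abs_window_le: "\<bar>window w x z\<bar> \<le> 1"
  using near_mean_bounds[of w x] by (auto simp: window_def)

lemma sum_abs_window: "(\<Sum>z<n. \<bar>window w x z\<bar>) \<le> 2 * width w"
proof -
  have "(\<Sum>z<n. \<bar>window w x z\<bar>) \<le> (\<Sum>z<n. of_bool (near w x z) + near_mean w x)"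
    using near_mean_bounds[of w x] by (intro sum_mono) (auto simp: window_def)
  also have "\<dots> = 2 * (real n * near_mean w x)"
    by (simp only: sum.distrib sum_near_eq) simp
  finally show ?thesis using near_mean_bounds(3)[of w x] by linarith
qed

text \<open>This is \<open>n\<close> times the Bernoulli variance \<open>p * (1 - p)\<close> with
  \<open>p = near_mean w x\<close>.\<close>

lemma sum_window_sq: "(\<Sum>z<n. (window w x z)\<^sup>2) \<le> width w"
proof -
  have "(\<Sum>z<n. (window w x z)\<^sup>2) = (\<Sum>z<n. (1 - 2 * near_mean w x) * of_bool (near w x z) + (near_mean w x)\<^sup>2)"
    by (intro sum.cong refl) (auto simp: window_def power2_eq_square algebra_simps)
  also have "\<dots> = (1 - 2 * near_mean w x) * (real n * near_mean w x) + real n * (near_mean w x)\<^sup>2"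
    by (simp only: sum.distrib sum_distrib_left[symmetric] sum_near_eq) simp
  also have "\<dots> = real n * near_mean w x * (1 - near_mean w x)"
    by (simp add: power2_eq_square algebra_simps)
  also have "\<dots> \<le> real n * near_mean w x * 1"
    using near_mean_bounds[of w x] by (intro mult_left_mono) auto
  finally show ?thesis using near_mean_bounds(3)[of w x] by simp
qed

text \<open>As in sampling without replacement: for centred functions the sum over distinct pairs is
  minus the diagonal sum.\<close>

lemma pair_mean_window: "\<bar>pair_mean (\<lambda>u v. window w x u * window w y v)\<bar> \<le> 4 * width w / (real n)\<^sup>2"
proof -
  have "(\<Sum>v<n. \<Sum>u\<in>{..<n} - {v}. window w x u * window w y v) = (\<Sum>v<n. - window w x v * window w y v)"
    by (intro sum.cong refl) (simp add: sum_distrib_right[symmetric] sum_diff1 sum_window)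
  also have "\<bar>\<dots>\<bar> \<le> (\<Sum>v<n. \<bar>- window w x v * window w y v\<bar>)" by (rule sum_abs)
  also have "\<dots> \<le> (\<Sum>v<n. 1 * \<bar>window w y v\<bar>)"
    unfolding abs_mult using abs_window_le by (intro sum_mono mult_right_mono) auto
  also have "\<dots> \<le> 2 * width w" using sum_abs_window[of w y] by simp
  finally have "\<bar>pair_mean (\<lambda>u v. window w x u * window w y v)\<bar> \<le> 2 * width w / (real n * (real n - 1))"
    using n_pos by (simp add: pair_mean_def abs_mult divide_right_mono)
  also have "\<dots> \<le> 2 * width w / (real n * (real n / 2))"
    using n_pos width_pos[of w] by (intro divide_left_mono mult_left_mono mult_pos_pos) auto
  finally show ?thesis by (simp add: power2_eq_square)
qed

section \<open>Second moment of the contribution of removed cards\<close>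

lemma pair_mean_diff: "pair_mean (\<lambda>x y. G x y - G' x y) = pair_mean G - pair_mean G'"
  by (simp add: pair_mean_def sum_subtractf diff_divide_distrib)

text \<open>Signed, hence linear in \<open>G\<close>, so that a non-monotone \<open>G\<close> can be
  split into monotone pieces.\<close>

definition late_error :: "nat \<Rightarrow> nat \<Rightarrow> nat \<Rightarrow> (nat \<Rightarrow> nat \<Rightarrow> real) \<Rightarrow> real" where
  "late_error t x y G = avg n t (\<lambda>\<omega>. of_bool (late \<omega> x y) * G (pos \<omega> x) (pos \<omega> y)) - late_prob t * pair_mean G"

lemma late_error_diff: "late_error t x y (\<lambda>u v. G u v - G' u v) = late_error t x y G - late_error t x y G'"
  by (simp add: late_error_def pair_mean_diff right_diff_distrib avg_diff)

lemma late_error_product: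
  assumes xy: "x < n" "y < n" "x \<noteq> y"
    and s: "\<And>u. s (Suc u) \<le> s u" "\<And>u. 0 \<le> s u \<and> s u \<le> 1"
    and \<gamma>: "\<And>v. 0 \<le> \<gamma> v"
  shows "\<bar>late_error t x y (\<lambda>u v. s u * \<gamma> v)\<bar> \<le> 4 * (\<Sum>v<n. \<gamma> v) / (real n)\<^sup>2"
proof -
  have "\<bar>late_error t x y (\<lambda>u v. s u * \<gamma> v)\<bar> \<le> 4 * (\<Sum>v<n. \<gamma> v) / (real n)\<^sup>2 * (1 - survival t)"
    unfolding late_error_def
    using s \<gamma> by (intro late_approx xy) 
      (auto simp: side_antimono_def mult_right_mono mult_left_le_one_le)
  also have "\<dots> \<le> 4 * (\<Sum>v<n. \<gamma> v) / (real n)\<^sup>2 * 1"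
    using survival_bounds[of t] \<gamma> by (intro mult_left_mono) (auto intro!: divide_nonneg_nonneg sum_nonneg)
  finally show ?thesis by simp
qed

text \<open>The window is a combination of three functions decreasing in \<open>u\<close> with
  values in \<open>[0, 1]\<close>: the indicators of \<open>u <= x + w\<close> and of
  \<open>u + w < x\<close>, and a constant. Hence 12 = 3 * 4.\<close>

lemma late_error_window_product:
  assumes xy: "x < n" "y < n" "x \<noteq> y"
    and \<gamma>: "\<And>v. 0 \<le> \<gamma> v"
  shows "\<bar>late_error t x y (\<lambda>u v. window w x u * \<gamma> v)\<bar> \<le> 12 * (\<Sum>v<n. \<gamma> v) / (real n)\<^sup>2"
proof -
  define S where "S = (\<Sum>v<n. \<gamma> v) / (real n)\<^sup>2"
  have S: "\<bar>late_error t x y (\<lambda>u v. s u * \<gamma> v)\<bar> \<le> 4 * S"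
    if "\<And>u. s (Suc u) \<le> s u" "\<And>u. 0 \<le> s u \<and> s u \<le> 1" for s
    using late_error_product[where s = s and \<gamma> = \<gamma>, OF xy that \<gamma>] by (simp add: S_def)
  have g: "window w x u = of_bool (u \<le> x + w) - of_bool (u + w < x) - near_mean w x" for u
    by (auto simp: window_def near_def)
  have "late_error t x y (\<lambda>u v. window w x u * \<gamma> v) = late_error t x y (\<lambda>u v. of_bool (u \<le> x + w) * \<gamma> v)
     - late_error t x y (\<lambda>u v. of_bool (u + w < x) * \<gamma> v) - late_error t x y (\<lambda>u v. near_mean w x * \<gamma> v)"
    unfolding g left_diff_distrib by (simp only: late_error_diff)
  moreover have "\<bar>late_error t x y (\<lambda>u v. of_bool (u \<le> x + w) * \<gamma> v)\<bar> \<le> 4 * S"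
    using near_mean_bounds by (intro S) auto
  moreover have "\<bar>late_error t x y (\<lambda>u v. of_bool (u + w < x) * \<gamma> v)\<bar> \<le> 4 * S"
    using near_mean_bounds by (intro S) auto
  moreover have "\<bar>late_error t x y (\<lambda>u v. near_mean w x * \<gamma> v)\<bar> \<le> 4 * S"
    using near_mean_bounds by (intro S) auto
  ultimately have "\<bar>late_error t x y (\<lambda>u v. window w x u * \<gamma> v)\<bar> \<le> 12 * S" by linarith
  then show ?thesis by (simp add: S_def)
qed

text \<open>The second factor need only be nonnegative with small total, so it is split into its
  indicator and its mean, each of total at most \<open>width w\<close>. With the main term, 28 = 12
  + 12 + 4.\<close>

lemma avg_late_window:
  assumes xy: "x < n" "y < n" "x \<noteq> y"
  shows "avg n t (\<lambda>\<omega>. of_bool (late \<omega> x y) * (window w x (pos \<omega> x) * window w y (pos \<omega> y))) \<le> 28 * width w / (real n)\<^sup>2"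
proof -
  let ?G = "\<lambda>u v. window w x u * window w y v"
  have "late_error t x y ?G = late_error t x y (\<lambda>u v. window w x u * of_bool (near w y v)) - late_error t x y (\<lambda>u v. window w x u * near_mean w y)"
    unfolding window_def[of w y] right_diff_distrib[of "window w x _"] by (rule late_error_diff)
  moreover have "\<bar>late_error t x y (\<lambda>u v. window w x u * of_bool (near w y v))\<bar> \<le> 12 * width w / (real n)\<^sup>2"
    by (rule order_trans[OF late_error_window_product[OF xy]])
       (use sum_near[of w y] in \<open>auto intro!: divide_right_mono\<close>)
  moreover have "\<bar>late_error t x y (\<lambda>u v. window w x u * near_mean w y)\<bar> \<le> 12 * width w / (real n)\<^sup>2"
    by (rule order_trans[OF late_error_window_product[OF xy]])
       (use near_mean_bounds[of w y] in \<open>auto intro!: divide_right_mono\<close>)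
  moreover have "late_prob t * pair_mean ?G \<le> 4 * width w / (real n)\<^sup>2"
  proof -
    have "late_prob t * pair_mean ?G \<le> late_prob t * \<bar>pair_mean ?G\<bar>"
      using late_prob_bounds[of t] by (intro mult_left_mono) auto
    also have "\<dots> \<le> 1 * (4 * width w / (real n)\<^sup>2)"
      using late_prob_bounds[of t] by (intro mult_mono pair_mean_window) auto
    finally show ?thesis by simp
  qed
  ultimately show ?thesis unfolding late_error_def by linarith
qed

definition f_removed :: "nat \<Rightarrow> (nat \<times> nat) list \<Rightarrow> real" where
  "f_removed w \<omega> = (\<Sum>x<n. of_bool (removed \<omega> x) * window w x (pos \<omega> x))"

lemma sum_pairs_bound:
  assumes "\<And>x. x < n \<Longrightarrow> A x x \<le> \<alpha> / real n"
    and "\<And>x y. x < n \<Longrightarrow> y < n \<Longrightarrow> x \<noteq> y \<Longrightarrow> A x y \<le> \<beta> / (real n)\<^sup>2" and "0 \<le> \<beta>"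
  shows "(\<Sum>x<n. \<Sum>y<n. A x y) \<le> \<alpha> + \<beta>"
proof -
  have "(\<Sum>x<n. \<Sum>y<n. A x y) = (\<Sum>x<n. A x x + (\<Sum>y\<in>{..<n} - {x}. A x y))"
    by (intro sum.cong refl sum.remove) auto
  also have "\<dots> \<le> (\<Sum>x<n. \<alpha> / real n + (\<Sum>y\<in>{..<n} - {x}. \<beta> / (real n)\<^sup>2))"
    using assms by (intro sum_mono add_mono) auto
  also have "\<dots> = \<alpha> + real n * ((real n - 1) * (\<beta> / (real n)\<^sup>2))"
    using n_pos two_le by (simp add: sum.distrib of_nat_diff distrib_left)
  also have "\<dots> \<le> \<alpha> + real n * (real n * (\<beta> / (real n)\<^sup>2))"
    using assms(3) n_pos by (intro add_left_mono mult_left_mono mult_right_mono) auto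
  also have "\<dots> = \<alpha> + \<beta>" using n_pos by (simp add: power2_eq_square)
  finally show ?thesis .
qed

lemma square_sum: "(\<Sum>x<n. h x)\<^sup>2 = (\<Sum>x<n. \<Sum>y<n. h x * (h y :: real))"
  by (simp add: power2_eq_square sum_product)

text \<open>Diagonal terms come from \<open>avg_removed\<close>; each other pair is split by which
  card was chosen last. Fewer than \<open>n^2\<close> pairs of order \<open>width w / n^2\<close>
  remain, and 57 = 1 + 2 * 28.\<close>

lemma avg_f_removed_sq: "avg n t (\<lambda>\<omega>. (f_removed w \<omega>)\<^sup>2) \<le> 57 * width w"
proof -
  let ?A = "\<lambda>x y \<omega>. of_bool (removed \<omega> x) * window w x (pos \<omega> x) * (of_bool (removed \<omega> y) * window w y (pos \<omega> y))"
  have "avg n t (\<lambda>\<omega>. (f_removed w \<omega>)\<^sup>2) = (\<Sum>x<n. \<Sum>y<n. avg n t (?A x y))"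
    unfolding f_removed_def square_sum avg_sum ..
  also have "\<dots> \<le> width w + 56 * width w"
  proof (rule sum_pairs_bound)
    fix x assume x: "x < n"
    have "avg n t (?A x x) = avg n t (\<lambda>\<omega>. of_bool (removed \<omega> x) * (window w x (pos \<omega> x))\<^sup>2)"
      by (rule avg_cong) (auto simp: power2_eq_square)
    also have "\<dots> = (1 - survival t) * (\<Sum>z<n. (window w x z)\<^sup>2) / real n"
      by (rule avg_removed[OF x])
    also have "\<dots> \<le> 1 * width w / real n"
      using survival_bounds[of t] sum_window_sq[of w x] by (intro divide_right_mono mult_mono sum_nonneg) auto
    finally show "avg n t (?A x x) \<le> width w / real n" by simp
  next
    fix x y assume xy: "x < n" "y < n" "x \<noteq> y"
    let ?L = "\<lambda>x y \<omega>. of_bool (late \<omega> x y) * (window w x (pos \<omega> x) * window w y (pos \<omega> y))"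
    have "avg n t (?A x y) = avg n t (\<lambda>\<omega>. ?L x y \<omega> + ?L y x \<omega>)"
    proof (rule avg_cong)
      fix \<omega>
      have "?A x y \<omega> = of_bool (removed \<omega> x \<and> removed \<omega> y) * (window w x (pos \<omega> x) * window w y (pos \<omega> y))"
        by auto
      then show "?A x y \<omega> = ?L x y \<omega> + ?L y x \<omega>"
        using both_removed[OF xy(3), of \<omega>] by (simp add: algebra_simps)
    qed
    also have "\<dots> \<le> 28 * width w / (real n)\<^sup>2 + 28 * width w / (real n)\<^sup>2"
      unfolding avg_add using xy by (intro add_mono avg_late_window) auto
    finally show "avg n t (?A x y) \<le> 56 * width w / (real n)\<^sup>2" by simp
  qed (use width_pos[of w] in auto)
  finally show ?thesis by simp
qed

section \<open>Unremoved cards and those among them that strayed\<close>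

definition unremoved_count :: "(nat \<times> nat) list \<Rightarrow> real" where
  "unremoved_count \<omega> = (\<Sum>x<n. of_bool (\<not> removed \<omega> x))"

lemma avg_unremoved_count: "avg n t unremoved_count = real n * survival t"
  unfolding unremoved_count_def[abs_def] avg_sum by (simp add: avg_unremoved)

text \<open>Survivals of distinct cards are negatively correlated, as
  \<open>1 - 2 / n <= (1 - 1 / n)^2\<close>; so the variance is at most the mean.\<close>

lemma avg_unremoved_count_sq: "avg n t (\<lambda>\<omega>. (unremoved_count \<omega>)\<^sup>2) \<le> real n * survival t + (real n * survival t)\<^sup>2"
proof -
  have "avg n t (\<lambda>\<omega>. (unremoved_count \<omega>)\<^sup>2) 
      = (\<Sum>x<n. \<Sum>y<n. avg n t (\<lambda>\<omega>. of_bool (\<not> removed \<omega> x) * of_bool (\<not> removed \<omega> y)))"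
    unfolding unremoved_count_def square_sum avg_sum ..
  also have "\<dots> \<le> real n * survival t + (real n * survival t)\<^sup>2"
  proof (rule sum_pairs_bound)
    fix x assume x: "x < n"
    then show "avg n t (\<lambda>\<omega>. of_bool (\<not> removed \<omega> x) * of_bool (\<not> removed \<omega> x)) \<le> real n * survival t / real n"
      using n_pos avg_unremoved[OF x, of t] by (simp add: of_bool_conj[symmetric] del: of_bool_not_iff)
  next
    fix x y assume xy: "x < n" "y < n" "x \<noteq> y"
    have "avg n t (\<lambda>\<omega>. of_bool (\<not> removed \<omega> x) * of_bool (\<not> removed \<omega> y)) = (1 - 2 / real n) ^ t"
      using avg_unremoved2[OF xy, of t] by (simp add: of_bool_conj del: of_bool_not_iff)
    also have "\<dots> \<le> ((1 - 1 / real n)\<^sup>2) ^ t"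
      using n_pos by (intro power_mono) (auto simp: power2_eq_square field_simps)
    also have "\<dots> = (survival t)\<^sup>2"
      by (simp add: survival_def power_mult[symmetric] mult.commute)
    finally show "avg n t (\<lambda>\<omega>. of_bool (\<not> removed \<omega> x) * of_bool (\<not> removed \<omega> y)) \<le> (real n * survival t)\<^sup>2 / (real n)\<^sup>2"
      using n_pos by (simp add: power_mult_distrib)
  qed auto
  finally show ?thesis .
qed

definition far_count :: "nat \<Rightarrow> (nat \<times> nat) list \<Rightarrow> real" where
  "far_count w \<omega> = (\<Sum>x<n. of_bool (\<not> removed \<omega> x \<and> \<not> near w x (pos \<omega> x)))"

text \<open>Chebyshev's inequality with \<open>avg_displacement\<close>.\<close>

lemma avg_far_count:
  assumes "0 < w"
  shows "avg n t (far_count w) \<le> real n * (6 * real t * survival t / (real w)\<^sup>2)"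
proof -
  have "avg n t (\<lambda>\<omega>. of_bool (\<not> removed \<omega> x \<and> \<not> near w x (pos \<omega> x))) \<le> 6 * real t * survival t / (real w)\<^sup>2"
    if x: "x < n" for x
  proof -
    have "avg n t (\<lambda>\<omega>. of_bool (\<not> removed \<omega> x \<and> \<not> near w x (pos \<omega> x))) 
       \<le> avg n t (\<lambda>\<omega>. (1 / (real w)\<^sup>2) * (of_bool (\<not> removed \<omega> x) * (real (pos \<omega> x) - real x)\<^sup>2))"
    proof (rule avg_mono)
      fix \<omega>
      have "(real w)\<^sup>2 \<le> (real (pos \<omega> x) - real x)\<^sup>2" if "\<not> near w x (pos \<omega> x)"
      proof -
        have "\<bar>real w\<bar> \<le> \<bar>real (pos \<omega> x) - real x\<bar>" using that by (auto simp: near_def)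
        then show ?thesis by (simp only: abs_le_square_iff)
      qed
      then show "of_bool (\<not> removed \<omega> x \<and> \<not> near w x (pos \<omega> x)) \<le> 
        (1 / (real w)\<^sup>2) * (of_bool (\<not> removed \<omega> x) * (real (pos \<omega> x) - real x)\<^sup>2)"
        using assms by (auto simp: field_simps)
    qed
    also have "\<dots> \<le> (1 / (real w)\<^sup>2) * (6 * real t * survival t)"
      unfolding avg_cmult by (intro mult_left_mono avg_displacement x) auto
    finally show ?thesis by simp
  qed
  then have "(\<Sum>x<n. avg n t (\<lambda>\<omega>. of_bool (\<not> removed \<omega> x \<and> \<not> near w x (pos \<omega> x)))) 
     \<le> (\<Sum>x<n. 6 * real t * survival t / (real w)\<^sup>2)"
    by (intro sum_mono) auto
  then show ?thesis
    unfolding far_count_def[abs_def] avg_sum by simp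
qed

end

subsection \<open>Separating the walk from the uniform measure\<close>

lemma set_pmf_rti_step_finite: "finite (set_pmf (rti_step n \<sigma>))"
proof (cases "n = 0")
  case False
  then have "{..<n} \<noteq> {}" by auto
  then show ?thesis by (auto simp: rti_step_def set_pmf_of_set)
qed (simp add: rti_step_def)

lemma rti_walk_0 [simp]: "rti_walk n \<sigma> 0 = return_pmf \<sigma>"
  by (simp add: rti_walk_def)

lemma rti_walk_Suc: "rti_walk n \<sigma> (Suc t) = bind_pmf (rti_walk n \<sigma> t) (rti_step n)"
  by (simp add: rti_walk_def)

lemma set_pmf_rti_walk_finite: "finite (set_pmf (rti_walk n \<sigma> t))"
  by (induction t) (auto simp: rti_walk_Suc set_pmf_rti_step_finite)

lemma tv_dist_bounds:
  "\<bar>measure_pmf.prob p A - measure_pmf.prob q A\<bar> \<le> tv_dist p q" "tv_dist p q \<le> 1"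
proof -
  have *: "\<bar>measure_pmf.prob p A - measure_pmf.prob q A\<bar> \<le> 1" for A
    using measure_pmf.prob_le_1[of p A] measure_pmf.prob_le_1[of q A]
      measure_nonneg[of p A] measure_nonneg[of q A] by linarith
  then show "tv_dist p q \<le> 1"
    unfolding tv_dist_def by (intro cSUP_least) auto
  have "bdd_above (range (\<lambda>A. \<bar>measure_pmf.prob p A - measure_pmf.prob q A\<bar>))"
    using * by (intro bdd_aboveI[of _ 1]) auto
  then show "\<bar>measure_pmf.prob p A - measure_pmf.prob q A\<bar> \<le> tv_dist p q"
    unfolding tv_dist_def by (intro cSUP_upper) auto
qed

lemma finite_deck_orders: "finite (deck_orders n)"
  by (simp add: deck_orders_def finite_permutations)

lemma id_in_deck_orders: "id \<in> deck_orders n"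
  by (simp add: deck_orders_def permutes_id)

lemma card_deck_orders: "card (deck_orders n) = fact n"
  by (simp add: deck_orders_def card_permutations)

lemma rti_d_le_1: "rti_d n t \<le> 1"
  unfolding rti_d_def using finite_deck_orders[of n] id_in_deck_orders[of n]
  by (subst Max_le_iff) (auto intro: tv_dist_bounds(2))

lemma rti_d_ge:
  "measure_pmf.prob (rti_walk n id t) A - measure_pmf.prob (uniform_perm n) A \<le> rti_d n t"
proof -
  have "measure_pmf.prob (rti_walk n id t) A - measure_pmf.prob (uniform_perm n) A
     \<le> tv_dist (rti_walk n id t) (uniform_perm n)"
    using tv_dist_bounds(1)[of "rti_walk n id t" A "uniform_perm n"] by linarith
  also have "\<dots> \<le> rti_d n t"
    unfolding rti_d_def using finite_deck_orders id_in_deck_orders by (intro Max_ge) auto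
  finally show ?thesis .
qed

section \<open>Expectations of the walk as averages over steps\<close>

context deck
begin

text \<open>The walk picks a label and \<open>avg\<close> a position; \<open>pos \<omega>\<close>
  permutes \<open>{..<n}\<close>, so a uniform label has a uniform position.\<close>

lemma expectation_rti_step:
  assumes "\<omega> \<in> steps n t"
  shows "measure_pmf.expectation (rti_step n (pos \<omega>)) (h :: _ \<Rightarrow> real)
     = (\<Sum>a<n. \<Sum>k<n. h (pos ((a, k) # \<omega>))) / (real n)\<^sup>2"
proof -
  have ne: "{..<n} \<noteq> {}" using n_pos(1) by blast
  have inj: "inj (pos \<omega>)" by (auto simp: inj_def)
  have bij: "bij_betw (pos \<omega>) {..<n} {..<n}"
    unfolding bij_betw_def using pos_less[OF assms]
    by (intro conjI endo_inj_surj) (auto simp: inj_on_def)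
  have "measure_pmf.expectation (rti_step n (pos \<omega>)) h
     = (\<Sum>j<n. \<Sum>k<n. h (rti_move (pos \<omega>) j k)) / (real n)\<^sup>2"
    using ne two_le by (simp add: rti_step_def pmf_expectation_bind_pmf_of_set set_pmf_of_set 
        sum_distrib_left[symmetric] power2_eq_square divide_inverse)
  also have "(\<Sum>j<n. \<Sum>k<n. h (rti_move (pos \<omega>) j k)) = (\<Sum>j<n. \<Sum>k<n. h (pos ((pos \<omega> j, k) # \<omega>)))"
    by (intro sum.cong refl arg_cong[of _ _ h]) (simp add: rti_move_conv_move[OF inj] fun_eq_iff)
  also have "\<dots> = (\<Sum>a<n. \<Sum>k<n. h (pos ((a, k) # \<omega>)))"
    by (rule sum.reindex_bij_betw[OF bij, of "\<lambda>a. \<Sum>k<n. h (pos ((a, k) # \<omega>))"])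
  finally show ?thesis .
qed

lemma expectation_rti_walk:
  "measure_pmf.expectation (rti_walk n id t) (h :: _ \<Rightarrow> real) = avg n t (\<lambda>\<omega>. h (pos \<omega>))"
proof (induction t arbitrary: h)
  case 0
  have "pos [] = (\<lambda>x. x)" by auto
  then show ?case by (simp add: id_def)
next
  case (Suc t)
  have "measure_pmf.expectation (rti_walk n id (Suc t)) h
     = measure_pmf.expectation (rti_walk n id t) (\<lambda>\<sigma>. measure_pmf.expectation (rti_step n \<sigma>) h)"
    unfolding rti_walk_Suc
    by (subst pmf_expectation_bind[of "set_pmf (rti_walk n id t)"],
        simp_all add: set_pmf_rti_walk_finite set_pmf_rti_step_finite,
        subst integral_measure_pmf_real[of "set_pmf (rti_walk n id t)"])
       (auto simp: set_pmf_rti_walk_finite mult.commute)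
  also have "\<dots> = avg n (Suc t) (\<lambda>\<omega>. h (pos \<omega>))"
    unfolding Suc avg_Suc by (rule avg_cong) (rule expectation_rti_step)
  finally show ?case .
qed

lemma prob_rti_walk:
  "measure_pmf.prob (rti_walk n id t) A = avg n t (\<lambda>\<omega>. of_bool (pos \<omega> \<in> A))"
  using expectation_rti_walk[of t "indicator A"] by (simp add: indicator_def of_bool_def)

lemma prob_uniform_perm:
  "measure_pmf.prob (uniform_perm n) A = (\<Sum>\<sigma>\<in>deck_orders n. of_bool (\<sigma> \<in> A)) / fact n"
proof -
  have "measure_pmf.prob (uniform_perm n) A = measure_pmf.expectation (uniform_perm n) (indicator A)"
    by simp
  also have "\<dots> = (\<Sum>\<sigma>\<in>deck_orders n. indicator A \<sigma>) / fact n"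
    unfolding uniform_perm_def using finite_deck_orders[of n] id_in_deck_orders[of n]
    by (subst integral_pmf_of_set) (auto simp: card_deck_orders)
  finally show ?thesis by (simp add: indicator_def of_bool_def)
qed

section \<open>One- and two-card marginals of the uniform measure\<close>

lemma sum_deck_orders_compose:
  "\<tau> permutes {..<n} \<Longrightarrow> (\<Sum>\<sigma>\<in>deck_orders n. F (\<sigma> \<circ> \<tau>)) = (\<Sum>\<sigma>\<in>deck_orders n. F \<sigma>)"
  unfolding deck_orders_def by (rule sum_permutations_compose_right[symmetric])

lemma sum_deck_orders_single:
  assumes "x < n"
  shows "(\<Sum>\<sigma>\<in>deck_orders n. \<phi> (\<sigma> x)) / fact n = (\<Sum>z<n. \<phi> z :: real) / real n"
proof -
  have *: "(\<Sum>\<sigma>\<in>deck_orders n. \<phi> (\<sigma> x)) = (\<Sum>\<sigma>\<in>deck_orders n. \<phi> (\<sigma> y))" if "y < n" for y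
    using sum_deck_orders_compose[of "Transposition.transpose y x" "\<lambda>\<sigma>. \<phi> (\<sigma> y)"] assms that
    by (simp add: permutes_swap_id)
  have "real n * (\<Sum>\<sigma>\<in>deck_orders n. \<phi> (\<sigma> x)) = (\<Sum>y<n. \<Sum>\<sigma>\<in>deck_orders n. \<phi> (\<sigma> x))"
    by simp
  also have "\<dots> = (\<Sum>y<n. \<Sum>\<sigma>\<in>deck_orders n. \<phi> (\<sigma> y))"
    by (rule sum.cong[OF refl]) (simp add: * del: sum_constant)
  also have "\<dots> = (\<Sum>\<sigma>\<in>deck_orders n. \<Sum>y<n. \<phi> (\<sigma> y))" by (rule sum.swap)
  also have "\<dots> = (\<Sum>\<sigma>\<in>deck_orders n. \<Sum>z<n. \<phi> z)"
    by (intro sum.cong refl sum.reindex_bij_betw permutes_imp_bij) (auto simp: deck_orders_def)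
  also have "\<dots> = fact n * (\<Sum>z<n. \<phi> z)" by (simp add: card_deck_orders)
  finally show ?thesis using n_pos by (simp add: field_simps)
qed

lemma sum_deck_orders_pair:
  assumes "x < n" "y < n" "x \<noteq> y"
  shows "(\<Sum>\<sigma>\<in>deck_orders n. G (\<sigma> x) (\<sigma> y)) / fact n = pair_mean G"
proof -
  have *: "(\<Sum>\<sigma>\<in>deck_orders n. G (\<sigma> u) (\<sigma> v)) = (\<Sum>\<sigma>\<in>deck_orders n. G (\<sigma> x) (\<sigma> y))" 
    if "v \<in> {..<n}" "u \<in> {..<n} - {v}" for u v
  proof -
    \<comment> \<open>The first transposition sends \<open>x\<close> to \<open>u\<close> and
      \<open>y\<close> to \<open>?c\<close>. Since \<open>?c\<close> and \<open>v\<close> differ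
      from \<open>u\<close>, the second sends \<open>?c\<close> to \<open>v\<close> and fixes
      \<open>u\<close>; the case \<open>y = u\<close> is covered.\<close>
    let ?c = "Transposition.transpose x u y"
    let ?\<tau> = "Transposition.transpose ?c v \<circ> Transposition.transpose x u"
    have c: "?c \<noteq> u" "?c < n" using assms that by (auto simp: Transposition.transpose_def)
    have "?\<tau> permutes {..<n}"
      using c assms that by (intro permutes_compose permutes_swap_id) auto
    moreover have "?\<tau> x = u" "?\<tau> y = v"
      using c that by (auto simp: Transposition.transpose_def)
    ultimately show ?thesis
      using sum_deck_orders_compose[of ?\<tau> "\<lambda>\<sigma>. G (\<sigma> x) (\<sigma> y)"] by simp
  qed
  have "(real n * (real n - 1)) * (\<Sum>\<sigma>\<in>deck_orders n. G (\<sigma> x) (\<sigma> y)) 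
     = (\<Sum>v<n. \<Sum>u\<in>{..<n} - {v}. \<Sum>\<sigma>\<in>deck_orders n. G (\<sigma> x) (\<sigma> y))"
    using two_le by (simp add: of_nat_diff)
  also have "\<dots> = (\<Sum>v<n. \<Sum>u\<in>{..<n} - {v}. \<Sum>\<sigma>\<in>deck_orders n. G (\<sigma> u) (\<sigma> v))"
    by (rule sum.cong[OF refl], rule sum.cong[OF refl]) (rule *[symmetric])
  also have "\<dots> = (\<Sum>v<n. \<Sum>\<sigma>\<in>deck_orders n. \<Sum>u\<in>{..<n} - {v}. G (\<sigma> u) (\<sigma> v))"
    by (rule sum.cong[OF refl], rule sum.swap)
  also have "\<dots> = (\<Sum>\<sigma>\<in>deck_orders n. \<Sum>v<n. \<Sum>u\<in>{..<n} - {v}. G (\<sigma> u) (\<sigma> v))"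
    by (rule sum.swap)
  also have "\<dots> = (\<Sum>\<sigma>\<in>deck_orders n. \<Sum>v<n. \<Sum>u\<in>{..<n} - {v}. G u v)"
  proof (rule sum.cong[OF refl])
    fix \<sigma> assume "\<sigma> \<in> deck_orders n"
    then have s: "bij_betw \<sigma> {..<n} {..<n}" by (auto simp: deck_orders_def permutes_imp_bij)
    have "(\<Sum>u\<in>{..<n} - {v}. G (\<sigma> u) (\<sigma> v)) = (\<Sum>u\<in>{..<n} - {\<sigma> v}. G u (\<sigma> v))" if "v \<in> {..<n}" for v
      using bij_betw_DiffI[OF s, of "{v}" "{\<sigma> v}"] that s
      by (intro sum.reindex_bij_betw[of \<sigma> _ _ "\<lambda>u. G u (\<sigma> v)"]) (auto simp: bij_betw_def)
    then have "(\<Sum>v<n. \<Sum>u\<in>{..<n} - {v}. G (\<sigma> u) (\<sigma> v)) = (\<Sum>v<n. \<Sum>u\<in>{..<n} - {\<sigma> v}. G u (\<sigma> v))"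
      by (rule sum.cong[OF refl])
    also have "\<dots> = (\<Sum>v<n. \<Sum>u\<in>{..<n} - {v}. G u v)"
      by (rule sum.reindex_bij_betw[OF s, of "\<lambda>v. \<Sum>u\<in>{..<n} - {v}. G u v"])
    finally show "(\<Sum>v<n. \<Sum>u\<in>{..<n} - {v}. G (\<sigma> u) (\<sigma> v)) = \<dots>" .
  qed
  also have "\<dots> = fact n * (\<Sum>v<n. \<Sum>u\<in>{..<n} - {v}. G u v)" by (simp add: card_deck_orders)
  finally show ?thesis using n_pos by (simp add: pair_mean_def field_simps)
qed

section \<open>The test statistic and the lower bound\<close>

definition stat :: "nat \<Rightarrow> (nat \<Rightarrow> nat) \<Rightarrow> real" where
  "stat w \<sigma> = (\<Sum>x<n. window w x (\<sigma> x))"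

lemma uniform_stat_sq: "(\<Sum>\<sigma>\<in>deck_orders n. (stat w \<sigma>)\<^sup>2) / fact n \<le> 5 * width w"
proof -
  let ?A = "\<lambda>x y. (\<Sum>\<sigma>\<in>deck_orders n. window w x (\<sigma> x) * window w y (\<sigma> y)) / fact n"
  have "(\<Sum>\<sigma>\<in>deck_orders n. (stat w \<sigma>)\<^sup>2) = (\<Sum>\<sigma>\<in>deck_orders n. \<Sum>x<n. \<Sum>y<n. window w x (\<sigma> x) * window w y (\<sigma> y))"
    by (simp add: stat_def square_sum)
  also have "\<dots> = (\<Sum>x<n. \<Sum>\<sigma>\<in>deck_orders n. \<Sum>y<n. window w x (\<sigma> x) * window w y (\<sigma> y))"
    by (rule sum.swap)
  also have "\<dots> = (\<Sum>x<n. \<Sum>y<n. \<Sum>\<sigma>\<in>deck_orders n. window w x (\<sigma> x) * window w y (\<sigma> y))"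
    by (intro sum.cong refl sum.swap)
  finally have "(\<Sum>\<sigma>\<in>deck_orders n. (stat w \<sigma>)\<^sup>2) / fact n = (\<Sum>x<n. \<Sum>y<n. ?A x y)"
    by (simp add: sum_divide_distrib)
  also have "\<dots> \<le> width w + 4 * width w"
  proof (rule sum_pairs_bound)
    fix x assume x: "x < n"
    show "?A x x \<le> width w / real n"
      using sum_deck_orders_single[OF x, of "\<lambda>z. (window w x z)\<^sup>2"] sum_window_sq[of w x] n_pos
      by (simp add: power2_eq_square divide_right_mono)
  next
    fix x y assume xy: "x < n" "y < n" "x \<noteq> y"
    show "?A x y \<le> 4 * width w / (real n)\<^sup>2"
      using sum_deck_orders_pair[OF xy, of "\<lambda>u v. window w x u * window w y v"] pair_mean_window[of w x y] by simp
  qed (use width_pos[of w] in auto)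
  finally show ?thesis by simp
qed

text \<open>Since \<open>near_mean w x\<close> is at most \<open>1 / 7\<close>, an unremoved card
  contributes at least \<open>6 / 7\<close> if near and at least \<open>6 / 7 - 1\<close> if
  far.\<close>

lemma stat_ge:
  assumes "width w / real n \<le> 1 / 7"
  shows "f_removed w \<omega> + 6 / 7 * unremoved_count \<omega> - far_count w \<omega> \<le> stat w (pos \<omega>)"
proof -
  have p: "near_mean w x \<le> 1 / 7" for x
  proof -
    have "near_mean w x \<le> width w / real n" using near_mean_bounds(3)[of w x] n_pos by (simp add: field_simps)
    with assms show ?thesis by linarith
  qed
  have "f_removed w \<omega> + 6 / 7 * unremoved_count \<omega> - far_count w \<omega> 
     = (\<Sum>x<n. of_bool (removed \<omega> x) * window w x (pos \<omega> x) + 6 / 7 * of_bool (\<not> removed \<omega> x)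
          - of_bool (\<not> removed \<omega> x \<and> \<not> near w x (pos \<omega> x)))"
    by (simp only: f_removed_def unremoved_count_def far_count_def sum.distrib sum_subtractf sum_distrib_left)
  also have "\<dots> \<le> (\<Sum>x<n. window w x (pos \<omega> x))"
  proof (rule sum_mono)
    fix x
    show "of_bool (removed \<omega> x) * window w x (pos \<omega> x) + 6 / 7 * of_bool (\<not> removed \<omega> x)
          - of_bool (\<not> removed \<omega> x \<and> \<not> near w x (pos \<omega> x)) \<le> window w x (pos \<omega> x)"
      using p[of x] by (auto simp: window_def)
  qed
  finally show ?thesis by (simp add: stat_def)
qed

text \<open>The threshold \<open>m / 2\<close> lies between the uniform mean 0 of
  \<open>stat w\<close> and the contribution of the unremoved cards, roughly at least
  \<open>6 / 7 * m\<close>. The leading constant is 3668 = 20 + 64 * 57.\<close>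

lemma rti_d_lower_bound:
  fixes t :: nat
  assumes w: "0 < w" "width w / real n \<le> 1 / 7"
  defines "m \<equiv> real n * survival t"
  shows "1 - (3668 * (width w / m\<^sup>2) + 64 / m + 48 * real t / (real w)\<^sup>2) \<le> rti_d n t"
proof -
  define A where "A = {\<sigma>. m / 2 \<le> stat w \<sigma>}"
  have m: "0 < m" using n_pos survival_bounds[of t] by (simp add: m_def)
  have "measure_pmf.prob (uniform_perm n) A \<le> (\<Sum>\<sigma>\<in>deck_orders n. 4 / m\<^sup>2 * (stat w \<sigma>)\<^sup>2) / fact n"
    unfolding prob_uniform_perm
  proof (intro divide_right_mono sum_mono)
    fix \<sigma>
    have "1 \<le> 4 / m\<^sup>2 * (stat w \<sigma>)\<^sup>2" if "m / 2 \<le> stat w \<sigma>"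
      using power_mono[OF that, of 2] m by (simp add: field_simps power2_eq_square)
    then show "of_bool (\<sigma> \<in> A) \<le> 4 / m\<^sup>2 * (stat w \<sigma>)\<^sup>2"
      by (auto simp: A_def)
  qed auto
  also have "\<dots> = 4 / m\<^sup>2 * ((\<Sum>\<sigma>\<in>deck_orders n. (stat w \<sigma>)\<^sup>2) / fact n)"
    by (simp add: sum_distrib_left)
  also have "\<dots> \<le> 4 / m\<^sup>2 * (5 * width w)"
    by (intro mult_left_mono uniform_stat_sq) auto
  finally have U: "measure_pmf.prob (uniform_perm n) A \<le> 20 * (width w / m\<^sup>2)"
    by simp
  have "1 - measure_pmf.prob (rti_walk n id t) A = avg n t (\<lambda>\<omega>. 1 - of_bool (pos \<omega> \<in> A))"
    using n_pos by (simp only: prob_rti_walk avg_diff avg_const)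
  \<comment> \<open>The middle bracket is \<open>64 / m^2 * (N - m)^2\<close> with
    \<open>N = unremoved_count \<omega>\<close>, expanded for linearity of
    \<open>avg\<close>.\<close>
  also have "\<dots> \<le> avg n t (\<lambda>\<omega>. 64 / m\<^sup>2 * (f_removed w \<omega>)\<^sup>2 
      + (64 / m\<^sup>2 * (unremoved_count \<omega>)\<^sup>2 - 128 / m * unremoved_count \<omega> + 64) + 8 / m * far_count w \<omega>)"
  proof (rule avg_mono)
    fix \<omega>
    define F N C where "F = f_removed w \<omega>" and "N = unremoved_count \<omega>" and "C = far_count w \<omega>"
    have C: "0 \<le> C" by (auto simp: C_def far_count_def intro!: sum_nonneg)
    have N: "64 / m\<^sup>2 * N\<^sup>2 - 128 / m * N + 64 = 64 / m\<^sup>2 * (N - m)\<^sup>2"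
      using m by (simp add: field_simps power2_eq_square)
    have sq: "1 \<le> 64 / m\<^sup>2 * z\<^sup>2" if "m / 8 \<le> \<bar>z\<bar>" for z
      using power_mono[OF that, of 2] m by (simp add: field_simps power2_eq_square)
    have nn: "0 \<le> 64 / m\<^sup>2 * F\<^sup>2" "0 \<le> 64 / m\<^sup>2 * (N - m)\<^sup>2" "0 \<le> 8 / m * C"
      using m C by auto
    have "1 \<le> 64 / m\<^sup>2 * F\<^sup>2 + 64 / m\<^sup>2 * (N - m)\<^sup>2 + 8 / m * C" if "pos \<omega> \<notin> A"
    proof -
      have "F + 6 / 7 * N - C < m / 2"
        using that stat_ge[OF w(2), of \<omega>] by (simp add: A_def F_def N_def C_def)
      \<comment> \<open>If all three failed, the left side would exceed
        \<open>- m / 8 + 6 / 7 * (7 / 8 * m) - m / 8 = m / 2\<close>; the bound \<open>1 / 7\<close>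
        is tuned to this.\<close>
      then consider "m / 8 \<le> \<bar>F\<bar>" | "m / 8 \<le> \<bar>N - m\<bar>" | "m / 8 \<le> C"
        by linarith
      then show ?thesis
      proof cases
        case 1
        then show ?thesis using sq[of F] nn by linarith
      next
        case 2
        then show ?thesis using sq[of "N - m"] nn by linarith
      next
        case 3
        then have "1 \<le> 8 / m * C" using m by (simp add: field_simps)
        with nn show ?thesis by linarith
      qed
    qed
    then show "1 - of_bool (pos \<omega> \<in> A) \<le> 64 / m\<^sup>2 * (f_removed w \<omega>)\<^sup>2 
      + (64 / m\<^sup>2 * (unremoved_count \<omega>)\<^sup>2 - 128 / m * unremoved_count \<omega> + 64) + 8 / m * far_count w \<omega>"
      unfolding F_def[symmetric] N_def[symmetric] C_def[symmetric] N
      using nn by auto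
  qed
  also have "\<dots> = 64 / m\<^sup>2 * avg n t (\<lambda>\<omega>. (f_removed w \<omega>)\<^sup>2) 
      + (64 / m\<^sup>2 * avg n t (\<lambda>\<omega>. (unremoved_count \<omega>)\<^sup>2) - 128 / m * m + 64) 
      + 8 / m * avg n t (far_count w)"
    using n_pos by (simp only: avg_add avg_diff avg_cmult avg_const avg_unremoved_count m_def[symmetric])
  also have "\<dots> \<le> 64 / m\<^sup>2 * (57 * width w) + (64 / m\<^sup>2 * (m + m\<^sup>2) - 128 / m * m + 64)
      + 8 / m * (m * (6 * real t / (real w)\<^sup>2))"
    using avg_f_removed_sq[of t w] avg_unremoved_count_sq[of t] avg_far_count[OF w(1), of t] m
    by (intro add_mono diff_mono mult_left_mono) (auto simp: m_def mult_ac)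
  also have "\<dots> = 3648 * (width w / m\<^sup>2) + 64 / m + 48 * real t / (real w)\<^sup>2"
    using m by (simp add: field_simps power2_eq_square)
  finally show ?thesis
    using U rti_d_ge[of n t A] by simp
qed

section \<open>Asymptotics\<close>

lemma survival_ge: "exp (- real t / real n - 2 * real t / (real n)\<^sup>2) \<le> survival t"
proof -
  have "- (1 / real n) - 2 * (1 / real n)\<^sup>2 \<le> ln (1 - 1 / real n)"
    using n_pos by (intro ln_one_minus_pos_lower_bound) auto
  then have "exp (real t * (- (1 / real n) - 2 * (1 / real n)\<^sup>2)) \<le> exp (real t * ln (1 - 1 / real n))"
    by (intro iffD2[OF exp_le_cancel_iff] mult_left_mono) auto
  also have "\<dots> = survival t"
    using n_pos by (simp add: survival_def exp_of_nat_mult)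
  finally show ?thesis by (simp add: algebra_simps power_divide)
qed

end

theorem theorem1:
  fixes t :: "nat \<Rightarrow> nat" and c :: "nat \<Rightarrow> real"
  assumes "\<forall>\<^sub>F n in sequentially.
     real (t n) = 3/4 * real n * ln (real n) - 1/4 * real n * ln (ln (real n)) - c n * real n"
    and "filterlim c at_top sequentially"
  shows "(\<lambda>n. rti_d n (t n)) \<longlonglongrightarrow> 1"
proof -
  \<comment> \<open>\<open>L\<close> must diverge to beat the displacement;
    \<open>L n <= c n\<close> keeps the width small against \<open>m^2\<close>, and
    \<open>L n <= ln n\<close> keeps it small against \<open>n\<close>.\<close>
  define L where "L n = min (c n) (ln (real n))" for n
  have ln_top: "filterlim (\<lambda>n. ln (real n)) at_top sequentially" by real_asymp
  have L_top: "filterlim L at_top sequentially"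
    unfolding filterlim_at_top
  proof
    fix Z
    show "\<forall>\<^sub>F n in sequentially. Z \<le> L n"
      using assms(2) ln_top unfolding filterlim_at_top L_def
      by (auto elim!: allE[of _ Z] intro: eventually_mono[OF eventually_conj])
  qed
  \<comment> \<open>18340 = 5 * 3668, as \<open>width w / m^2\<close> will be at most
    \<open>5 * exp (2 - c n)\<close>.\<close>
  define \<epsilon> where "\<epsilon> n = 18340 * exp (2 - c n) + 64 * exp (1 - c n) + 48 / (L n)\<^sup>2" for n
  have "\<epsilon> \<longlonglongrightarrow> 0"
  proof -
    have 1: "(\<lambda>n. exp (2 - c n)) \<longlonglongrightarrow> 0" and 2: "(\<lambda>n. exp (1 - c n)) \<longlonglongrightarrow> 0"
      by (rule filterlim_compose[OF _ assms(2)], real_asymp)+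
    have 3: "(\<lambda>n. 48 / (L n)\<^sup>2) \<longlonglongrightarrow> 0"
      by (rule filterlim_compose[OF _ L_top]) real_asymp
    show ?thesis
      using tendsto_add[OF tendsto_add[OF tendsto_mult[OF tendsto_const[of 18340] 1]
            tendsto_mult[OF tendsto_const[of 64] 2]] 3]
      unfolding \<epsilon>_def[abs_def] by simp
  qed
  then have lim: "(\<lambda>n. 1 - \<epsilon> n) \<longlonglongrightarrow> 1"
    using tendsto_diff[OF tendsto_const[of 1], of \<epsilon> 0] by simp
  have ev: "\<forall>\<^sub>F n in sequentially. 1 \<le> L n" "\<forall>\<^sub>F n in sequentially. 1 \<le> ln (real n)"
    "\<forall>\<^sub>F n in sequentially. 2 * ln (real n) \<le> real n"
    "\<forall>\<^sub>F n in sequentially. 5 * (ln (real n) * sqrt (real n * ln (real n))) / real n \<le> 1 / 7"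
    using L_top ln_top unfolding filterlim_at_top by (blast, blast, real_asymp, real_asymp)
  have "\<forall>\<^sub>F n in sequentially. 1 - \<epsilon> n \<le> rti_d n (t n)"
    using ev assms(1) eventually_ge_at_top[of 2]
  proof eventually_elim
    case (elim n)
    interpret deck n by standard fact
    define s where "s = sqrt (real n * ln (real n))"
    define y where "y = L n * s"
    define w where "w = nat \<lceil>y\<rceil>"
    define m where "m = real n * survival (t n)"
    have c: "1 \<le> c n" "L n \<le> c n" "L n \<le> ln (real n)" using elim(1) by (auto simp: L_def)
    have nln: "1 \<le> real n * ln (real n)"
      using mult_mono[of 1 "real n" 1 "ln (real n)"] elim(2) n_pos by simp
    then have s: "1 \<le> s" by (simp add: s_def)
    have s2: "s\<^sup>2 = real n * ln (real n)" using nln by (simp add: s_def)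
    \<comment> \<open>Prepares the comparison with \<open>m\<close>, which is at least
      \<open>sqrt s * exp (c n - 1)\<close>: the iterated logarithm in \<open>t n\<close> yields the
      fourth root of \<open>ln n\<close> in \<open>sqrt s\<close>.\<close>
    have s_exp: "s = exp ((ln (real n) + ln (ln (real n))) / 2)"
    proof -
      have "0 < ln (real n)" using elim(2) by linarith
      have "s = exp (ln s)" using s by simp
      also have "ln s = (ln (real n) + ln (ln (real n))) / 2"
        using \<open>0 < ln (real n)\<close> n_pos(2) by (simp add: s_def ln_sqrt ln_mult)
      finally show ?thesis .
    qed
    have y: "1 \<le> y" using mult_mono[of 1 "L n" 1 s] elim(1) s by (simp add: y_def)
    have w: "y \<le> real w" "real w \<le> y + 1" "0 < w"
      using y by (auto simp: w_def)
    \<comment> \<open>\<open>2 * (y + 1) + 1 <= 5 * y\<close> because \<open>1 <= y\<close>.\<close>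
    have M: "width w \<le> 5 * y" using w y by (simp add: width_def)
    have tn: "real (t n) / real n = 3/4 * ln (real n) - 1/4 * ln (ln (real n)) - c n"
      using elim(5) n_pos by (simp add: field_simps)
    have "ln (ln (real n)) \<ge> 0" using elim(2) by simp
    then have "real (t n) / real n \<le> ln (real n)" using tn c elim(2) by linarith
    \<comment> \<open>Hence the typical displacement is of order \<open>s\<close>, small against the
      window size \<open>L n * s\<close>.\<close>
    then have t_le: "real (t n) \<le> s\<^sup>2" using n_pos by (simp add: s2 field_simps)
    have "2 * real (t n) \<le> real n * real n"
      using t_le elim(3) mult_left_mono[OF elim(3), of "real n"] by (simp add: s2)
    \<comment> \<open>The second-order term in \<open>survival_ge\<close> costs at most a factor
      \<open>exp (- 1)\<close>; hence \<open>c n - 1\<close> below.\<close>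
    then have t2: "2 * real (t n) / (real n)\<^sup>2 \<le> 1" using n_pos by (simp add: power2_eq_square)
    have "exp (ln (real n)) * exp (- (real (t n) / real n) - 1) \<le> real n * survival (t n)"
      using survival_ge[of "t n"] t2 n_pos
      by (intro mult_mono order_trans[OF _ survival_ge]) auto
    then have "exp (ln (real n) - (real (t n) / real n) - 1) \<le> m"
      by (simp add: m_def exp_add[symmetric] algebra_simps)
    moreover have "ln (real n) - (real (t n) / real n) - 1 = (ln (real n) + ln (ln (real n))) / 4 + (c n - 1)"
      using tn by simp
    ultimately have m: "exp ((ln (real n) + ln (ln (real n))) / 4 + (c n - 1)) \<le> m" by simp
    have "exp (c n - 1) \<le> exp ((ln (real n) + ln (ln (real n))) / 4 + (c n - 1))"
      using elim(2) by simp
    then have m1: "exp (c n - 1) \<le> m" using m by linarith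
    have m0: "0 < m" using m1 exp_gt_zero[of "c n - 1"] by linarith
    have "s * exp (2 * c n - 2) = (exp ((ln (real n) + ln (ln (real n))) / 4 + (c n - 1)))\<^sup>2"
      by (simp add: s_exp exp_add[symmetric] exp_double[symmetric] field_simps)
    also have "\<dots> \<le> m\<^sup>2" using m by (intro power_mono) auto
    finally have m2: "s * exp (2 * c n - 2) \<le> m\<^sup>2" .
    have "width w / m\<^sup>2 \<le> 5 * exp (2 - c n)"
    proof -
      \<comment> \<open>\<open>m^2\<close> supplies \<open>exp (2 * c n - 2)\<close>; one factor
        \<open>exp (c n)\<close> pays for \<open>L n\<close> and the rest gives the decay.\<close>
      have "L n \<le> exp (c n)" using c exp_ge_add_one_self[of "c n"] by linarith
      then have "L n * s \<le> exp (c n) * s" using s by (intro mult_right_mono) auto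
      then have "width w \<le> 5 * (exp (c n) * s)" using M by (simp add: y_def)
      also have "exp (c n) = exp (2 - c n) * exp (2 * c n - 2)"
        by (simp add: exp_add[symmetric])
      also have "5 * (exp (2 - c n) * exp (2 * c n - 2) * s) = 5 * exp (2 - c n) * (s * exp (2 * c n - 2))"
        by simp
      also have "\<dots> \<le> 5 * exp (2 - c n) * m\<^sup>2"
        using m2 by (intro mult_left_mono) auto
      finally show ?thesis using m0 by (simp add: field_simps)
    qed
    moreover have "64 / m \<le> 64 * exp (1 - c n)"
    proof -
      have "64 / m \<le> 64 / exp (c n - 1)" using m1 m0 by (intro divide_left_mono) auto
      also have "\<dots> = 64 * exp (1 - c n)" by (simp add: exp_diff)
      finally show ?thesis .
    qed
    moreover have "48 * real (t n) / (real w)\<^sup>2 \<le> 48 / (L n)\<^sup>2"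
    proof -
      have "48 * real (t n) / (real w)\<^sup>2 \<le> 48 * s\<^sup>2 / y\<^sup>2"
        using t_le w y by (intro frac_le power_mono) auto
      also have "\<dots> = 48 / (L n)\<^sup>2" using s by (simp add: y_def power_mult_distrib)
      finally show ?thesis .
    qed
    moreover have "1 - (3668 * (width w / m\<^sup>2) + 64 / m + 48 * real (t n) / (real w)\<^sup>2) \<le> rti_d n (t n)"
      unfolding m_def
    proof (rule rti_d_lower_bound)
      have "width w / real n \<le> 5 * (ln (real n) * s) / real n"
        using M c(3) s n_pos 
        by (intro divide_right_mono order_trans[OF M]) (auto simp: y_def intro!: mult_right_mono)
      then show "width w / real n \<le> 1 / 7" using elim(4) unfolding s_def by (rule order_trans)
    qed (fact w)
    ultimately show ?case by (simp add: \<epsilon>_def)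
  qed
  then show ?thesis
    by (rule tendsto_sandwich[OF _ _ lim tendsto_const]) (simp add: rti_d_le_1)
qed

end
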